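(* Let $\Omega\subset\mathbb{R}^n$ be an arbitrary domain, let $X$ denote either $\Omega$ or $\overline{\Omega}$, and let $U\in\mathcal{G}(X)$. Then the following two conditions are equivalent: (i) $U$ is invertible in $\mathcal{G}(X)$, i.e., there exists $V\in\mathcal{G}(X)$ such that $UV=1$ in $\mathcal{G}(X)$. (ii) For each representative $(u(\varphi,x))_{\varphi\in\mathcal{A}_0(\mathbb{R}^n)}$ of $U$ and each compact set $K\subset X$ there exists $p\in\mathbb{N}$ such that for all $\varphi\in\mathcal{A}_p(\mathbb{R}^n)$ there is $\eta>0$ with $\inf_{x\in K}|u(\varphi_\varepsilon,x)|\ge\varepsilon^p$ for all $0<\varepsilon<\eta$.
   Context: $\mathcal{G}(X)$ is the full Colombeau algebra, defined as follows. For $q\in\mathbb{N}_0$ let $$\mathcal{A}_q(\mathbb{R})=\Bigl\{\varphi\in\mathcal{D}(\mathbb{R}) : \int\varphi(x)\,dx=1,\ \int x^k\varphi(x)\,dx=0 \text{ for } 1\le k\le q\Bigr\},$$ $$\mathcal{A}_q(\mathbb{R}^n)=\Bigl\{\varphi(x_1,\dots,x_n)=\prod_{i=1}^n\varphi_0(x_i) : \varphi_0\in\mathcal{A}_q(\mathbb{R})\Bigr\},$$ where $\mathcal{D}$ denotes the space of compactly supported smooth functions. For $\varphi\in\mathcal{A}_0(\mathbb{R}^n)$ and $\varepsilon>0$ put $\varphi_\varepsilon(x)=\varepsilon^{-n}\varphi(x/\varepsilon)$. Let $X$ be $\Omega$ or $\overline{\Omega}$, with $\Omega\subset\mathbb{R}^n$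 a domain. $\mathcal{E}(X)$ is the set of all maps $u:\mathcal{A}_0(\mathbb{R}^n)\times X\to\mathbb{R}$ such that $u(\varphi,\cdot)\in C^\infty(X)$ for all $\varphi\in\mathcal{A}_0(\mathbb{R}^n)$. $\mathcal{E}_{\mathrm{M}}(X)$ (moderate elements) consists of all $u\in\mathcal{E}(X)$ such that: for every compact $K\subset X$ and every $\alpha\in\mathbb{N}_0^n$ there is $N\in\mathbb{N}$ such that for all $\varphi\in\mathcal{A}_N(\mathbb{R}^n)$ there are $C>0$, $\eta>0$ with $\sup_{x\in K}|\partial^\alpha u(\varphi_\varepsilon,x)|\le C\varepsilon^{-N}$ for $0<\varepsilon<\eta$. $\mathcal{N}(X)$ (negligible elements) consists of all $u\in\mathcal{E}_{\mathrm{M}}(X)$ such that: for every compact $K\subset X$ and every $\alpha\in\mathbb{N}_0^n$ there is $N\in\mathbb{N}$ such that for all $q\ge N$ and all $\varphi\in\mathcal{A}_q(\mathbb{R}^n)$ there are $C>0$, $\eta>0$ with $\sup_{x\in K}|\partial^\alpha u(\varphi_\varepsilon,x)|\le C\varepsilon^{q-N}$ for $0<\varepsilon<\eta$. $\mathcal{G}(X)=\mathcal{E}_{\mathrm{M}}(X)/\mathcal{N}(X)$, an associative commutative algebra under pointwise operations on representatives; a representative of $U\in\mathcal{G}(X)$ is an element of $\mathcal{E}_{\mathrm{M}}(X)$ in the class $U$. *)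

theory Defs
  imports "HOL-Analysis.Analysis" "HOL-Algebra.QuotRing"
begin

section \<open>Mollifiers\<close>

definition test_functions :: "(real \<Rightarrow> real) set" where
  "test_functions =
     {\<phi>. (\<forall>k x. (deriv ^^ k) \<phi> differentiable (at x)) \<and> compact (closure {x. \<phi> x \<noteq> 0})}"

definition mollifiers_1d :: "nat \<Rightarrow> (real \<Rightarrow> real) set" where
  "mollifiers_1d q =
     {\<phi> \<in> test_functions.
        (LBINT x. \<phi> x) = 1 \<and> (\<forall>k\<in>{1..q}. (LBINT x. x ^ k * \<phi> x) = 0)}"

definition mollifiers :: "nat \<Rightarrow> (real ^ 'n \<Rightarrow> real) set" where
  "mollifiers q = {\<phi>. \<exists>\<phi>0 \<in> mollifiers_1d q. \<phi> = (\<lambda>x. \<Prod>i\<in>UNIV. \<phi>0 (x $ i))}"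

definition rescale :: "real \<Rightarrow> (real ^ 'n \<Rightarrow> real) \<Rightarrow> real ^ 'n \<Rightarrow> real" where
  "rescale \<epsilon> \<phi> = (\<lambda>x. \<phi> (x /\<^sub>R \<epsilon>) / \<epsilon> ^ CARD('n))"


section \<open>Smooth functions on a domain and on its closure\<close>

definition partial_deriv :: "'n \<Rightarrow> (real ^ 'n \<Rightarrow> real) \<Rightarrow> real ^ 'n \<Rightarrow> real" where
  "partial_deriv i f = (\<lambda>x. deriv (\<lambda>t. f (x + t *\<^sub>R axis i 1)) 0)"

text \<open>A fixed enumeration of the coordinates. On smooth functions the partial derivatives
  commute, so the order chosen here does not affect \<open>multi_deriv\<close>.\<close>

definition coord_list :: "'n::finite list" where
  "coord_list = (SOME is. distinct is \<and> set is = UNIV)"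

definition multi_deriv ::
    "('n::finite \<Rightarrow> nat) \<Rightarrow> (real ^ 'n \<Rightarrow> real) \<Rightarrow> real ^ 'n \<Rightarrow> real" where
  "multi_deriv \<alpha> = foldr (\<lambda>i. partial_deriv i ^^ \<alpha> i) coord_list"

primrec Ck_on :: "nat \<Rightarrow> (real ^ 'n) set \<Rightarrow> (real ^ 'n \<Rightarrow> real) \<Rightarrow> bool" where
  "Ck_on 0 \<Omega> = (\<lambda>f. continuous_on \<Omega> f)"
| "Ck_on (Suc k) \<Omega> = (\<lambda>f. f differentiable_on \<Omega> \<and> (\<forall>i. Ck_on k \<Omega> (partial_deriv i f)))"

text \<open>In what follows \<open>\<Omega>\<close> is open and \<open>X\<close> is \<open>\<Omega>\<close> or its closure. A function on \<open>X\<close> is smooth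
  if it is smooth in \<open>\<Omega>\<close> and it and all its derivatives extend continuously from \<open>\<Omega>\<close> to \<open>X\<close>
  (for the function itself the extension is the given one). For \<open>X = \<Omega>\<close> the extension
  conditions are vacuous and this is ordinary smoothness.\<close>

definition smooth_upto :: "(real ^ 'n) set \<Rightarrow> (real ^ 'n) set \<Rightarrow> (real ^ 'n \<Rightarrow> real) \<Rightarrow> bool" where
  "smooth_upto \<Omega> X f \<longleftrightarrow>
     (\<forall>k. Ck_on k \<Omega> f) \<and> continuous_on X f \<and>
     (\<forall>\<alpha>. \<exists>g. continuous_on X g \<and> (\<forall>x\<in>\<Omega>. g x = multi_deriv \<alpha> f x))"

text \<open>The derivative at a point of the closure outside \<open>\<Omega>\<close> is the value of the continuous
  extension. It depends on \<open>\<Omega>\<close> and not only on the closure, whose interior may be larger.\<close>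

definition deriv_upto ::
    "(real ^ 'n) set \<Rightarrow> ('n \<Rightarrow> nat) \<Rightarrow> (real ^ 'n \<Rightarrow> real) \<Rightarrow> real ^ 'n \<Rightarrow> real" where
  "deriv_upto \<Omega> \<alpha> f x =
     (if x \<in> \<Omega> then multi_deriv \<alpha> f x else Lim (at x within \<Omega>) (multi_deriv \<alpha> f))"


section \<open>The full Colombeau algebra\<close>

text \<open>Maps on \<open>mollifiers 0 \<times> X\<close> are represented as extensional functions, so that equality of
  functions is equality of maps.\<close>

type_synonym 'n net = "(real ^ 'n \<Rightarrow> real) \<times> (real ^ 'n) \<Rightarrow> real"

definition nets :: "(real ^ 'n) set \<Rightarrow> (real ^ 'n) set \<Rightarrow> 'n net set" where
  "nets \<Omega> X =
     {u \<in> extensional (mollifiers 0 \<times> X). \<forall>\<phi> \<in> mollifiers 0. smooth_upto \<Omega> X (\<lambda>x. u (\<phi>, x))}"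

text \<open>Suprema and infima are taken in the extended reals, so that they are the usual ones
  for every \<open>K\<close>, including the empty set.\<close>

definition moderate :: "(real ^ 'n) set \<Rightarrow> (real ^ 'n) set \<Rightarrow> 'n net set" where
  "moderate \<Omega> X =
     {u \<in> nets \<Omega> X.
        \<forall>K \<alpha>. compact K \<and> K \<subseteq> X \<longrightarrow>
          (\<exists>N\<ge>1. \<forall>\<phi> \<in> mollifiers N. \<exists>C>0. \<exists>\<eta>>0. \<forall>\<epsilon>. 0 < \<epsilon> \<and> \<epsilon> < \<eta> \<longrightarrow>
             (SUP x\<in>K. ereal \<bar>deriv_upto \<Omega> \<alpha> (\<lambda>y. u (rescale \<epsilon> \<phi>, y)) x\<bar>)
               \<le> ereal (C / \<epsilon> ^ N))}"

definition negligible_nets :: "(real ^ 'n) set \<Rightarrow> (real ^ 'n) set \<Rightarrow> 'n net set" where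
  "negligible_nets \<Omega> X =
     {u \<in> moderate \<Omega> X.
        \<forall>K \<alpha>. compact K \<and> K \<subseteq> X \<longrightarrow>
          (\<exists>N\<ge>1. \<forall>q\<ge>N. \<forall>\<phi> \<in> mollifiers q. \<exists>C>0. \<exists>\<eta>>0. \<forall>\<epsilon>. 0 < \<epsilon> \<and> \<epsilon> < \<eta> \<longrightarrow>
             (SUP x\<in>K. ereal \<bar>deriv_upto \<Omega> \<alpha> (\<lambda>y. u (rescale \<epsilon> \<phi>, y)) x\<bar>)
               \<le> ereal (C * \<epsilon> ^ (q - N)))}"

definition moderate_ring :: "(real ^ 'n) set \<Rightarrow> (real ^ 'n) set \<Rightarrow> 'n net ring" where
  "moderate_ring \<Omega> X =
     \<lparr>carrier = moderate \<Omega> X,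
      mult = (\<lambda>u v. restrict (\<lambda>z. u z * v z) (mollifiers 0 \<times> X)),
      one = restrict (\<lambda>_. 1) (mollifiers 0 \<times> X),
      zero = restrict (\<lambda>_. 0) (mollifiers 0 \<times> X),
      add = (\<lambda>u v. restrict (\<lambda>z. u z + v z) (mollifiers 0 \<times> X))\<rparr>"

text \<open>Elements are cosets, i.e. the sets of all their representatives.\<close>

definition colombeau :: "(real ^ 'n) set \<Rightarrow> (real ^ 'n) set \<Rightarrow> 'n net set ring" where
  "colombeau \<Omega> X = moderate_ring \<Omega> X Quot negligible_nets \<Omega> X"

end

theory Submission
  imports Defs "HOL-Library.Sublist" "HOL-Computational_Algebra.Polynomial"
begin

text \<open>A class with representative \<open>u\<close> can only be inverted by a class that is locally represented by
  \<open>1 / u\<close>, so invertibility has to control how close \<open>u (\<phi>\<^sub>\<epsilon>, \<cdot>)\<close> comes to zero on compact sets.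

  If \<open>u v = 1 + h\<close> with \<open>h\<close> negligible, then \<open>\<bar>u v\<bar> \<ge> 1 - \<epsilon>\<close> for small \<open>\<epsilon>\<close>, and
  \<open>\<bar>v\<bar> \<le> \<epsilon> powr (-M)\<close> forces \<open>\<bar>u\<bar> \<ge> \<epsilon> ^ Suc M\<close>. This is \<open>bounded_away_if_invertible\<close>.

  Conversely, the lower bound makes \<open>u (\<phi>\<^sub>\<epsilon>, \<cdot>)\<close> free of zeros only on one compact set at a time and
  only for small \<open>\<epsilon>\<close>, while a net must consist of functions that are smooth on all of \<open>X\<close>. The net
  \<open>v (\<psi>, \<cdot>) = u / (u\<^sup>2 + d\<^sub>\<psi>)\<close> overcomes this. Here \<open>d\<^sub>\<psi> \<ge> 0\<close> is smooth, positive where \<open>u (\<psi>, \<cdot>)\<close>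
  vanishes, and zero on the \<open>m\<close>-th set of a compact exhaustion as soon as \<open>u (\<psi>, \<cdot>)\<close> has no zero on
  the next one (\<open>regularizer\<close>). It is chosen from the function \<open>u (\<psi>, \<cdot>)\<close> alone, so it does not
  matter in how many ways \<open>\<psi>\<close> can be written as \<open>\<phi>\<^sub>\<epsilon>\<close>. Near every compact set \<open>u v = 1\<close> holds
  eventually, so all derivatives of \<open>u v - 1\<close> vanish there and \<open>u v - 1\<close> is negligible.

  That \<open>v\<close> is moderate follows by induction on the order of the derivative: the Leibniz rule for
  \<open>u v = 1\<close> expresses the highest derivative of \<open>v\<close> through \<open>v\<close> itself, derivatives of \<open>u\<close> and lower
  derivatives of \<open>v\<close> (\<open>leibniz_reciprocal\<close>). The same formula shows that all derivatives of a
  reciprocal extend continuously to the boundary.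

  Partial derivatives are taken in a fixed order of the coordinates. Derivatives are therefore
  indexed by lists of coordinates in that order; sublists of such lists are again of this kind, so
  the Leibniz rule does not leave the family. Bounds at boundary points of \<open>X\<close> follow by continuity
  from bounds in \<open>\<Omega>\<close> (\<open>closed_condition_on_C\<close>), which reduces moderateness and negligibility to
  estimates in \<open>\<Omega>\<close>.\<close>

section \<open>Partial derivatives and smooth functions\<close>

lemma has_real_derivative_partial_deriv:
  assumes "f differentiable (at x)"
  shows "((\<lambda>t. f (x + t *\<^sub>R axis i 1)) has_real_derivative partial_deriv i f x) (at 0)"
proof -
  have "(\<lambda>t. f (x + t *\<^sub>R axis i 1)) differentiable (at 0)"
    using differentiable_chain_at[of "\<lambda>t. x + t *\<^sub>R axis i 1" 0 f] assms
    by (auto simp: o_def)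
  then show ?thesis
    unfolding partial_deriv_def
    by (meson DERIV_deriv_iff_real_differentiable)
qed

lemma partial_deriv_add:
  assumes "f differentiable (at x)" "g differentiable (at x)"
  shows "partial_deriv i (\<lambda>x. f x + g x) x = partial_deriv i f x + partial_deriv i g x"
  unfolding partial_deriv_def[of i "\<lambda>x. f x + g x"]
  by (rule DERIV_imp_deriv)
     (rule DERIV_add[OF assms[THEN has_real_derivative_partial_deriv]])

lemma partial_deriv_mult:
  assumes "f differentiable (at x)" "g differentiable (at x)"
  shows "partial_deriv i (\<lambda>x. f x * g x) x = partial_deriv i f x * g x + f x * partial_deriv i g x"
  unfolding partial_deriv_def[of i "\<lambda>x. f x * g x"]
  using DERIV_mult[OF assms[THEN has_real_derivative_partial_deriv, of i]]
  by (auto intro!: DERIV_imp_deriv simp: algebra_simps)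

lemma partial_deriv_compose:
  assumes "f differentiable (at x)" "h differentiable (at (f x))"
  shows "partial_deriv i (\<lambda>x. h (f x)) x = deriv h (f x) * partial_deriv i f x"
proof -
  have "(h has_real_derivative deriv h (f x)) (at (f (x + 0 *\<^sub>R axis i 1)))"
    using assms(2) by (simp add: DERIV_deriv_iff_real_differentiable)
  from DERIV_chain2[OF this has_real_derivative_partial_deriv[OF assms(1)]]
  show ?thesis
    unfolding partial_deriv_def[of i "\<lambda>x. h (f x)"] by (rule DERIV_imp_deriv)
qed

text \<open>The right-hand side is written as a product so that \<open>Ck_on_mult\<close> applies to it in the induction
  for \<open>Ck_on_inverse\<close>.\<close>

lemma partial_deriv_inverse:
  assumes "f differentiable (at x)" "f x \<noteq> 0"
  shows "partial_deriv i (\<lambda>x. inverse (f x)) x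
       = - 1 * (partial_deriv i f x * (inverse (f x) * inverse (f x)))"
  unfolding partial_deriv_def[of i "\<lambda>x. inverse (f x)"]
  using DERIV_inverse'[OF has_real_derivative_partial_deriv[OF assms(1), of i]] assms(2)
  by (auto intro!: DERIV_imp_deriv simp: mult_ac)

lemma partial_deriv_const [simp]: "partial_deriv i (\<lambda>x. c) = (\<lambda>x. 0)"
  by (simp add: partial_deriv_def)

lemma partial_deriv_cong_open:
  assumes "open S" "x \<in> S" "\<And>y. y \<in> S \<Longrightarrow> f y = g y"
  shows "partial_deriv i f x = partial_deriv i g x"
  unfolding partial_deriv_def
proof (rule deriv_cong_ev[OF _ refl])
  have "((\<lambda>t. x + t *\<^sub>R axis i 1) \<longlongrightarrow> x + 0 *\<^sub>R axis i (1::real)) (nhds 0)"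
    by (intro tendsto_intros filterlim_ident)
  then have "((\<lambda>t. x + t *\<^sub>R axis i 1) \<longlongrightarrow> x) (nhds (0::real))" by simp
  from topological_tendstoD[OF this assms(1,2)]
  show "\<forall>\<^sub>F t in nhds 0. f (x + t *\<^sub>R axis i 1) = g (x + t *\<^sub>R axis i 1)"
    by eventually_elim (rule assms(3))
qed

lemma Ck_on_cong_open:
  assumes "open S" "\<And>y. y \<in> S \<Longrightarrow> f y = g y" "Ck_on k S f"
  shows "Ck_on k S g"
  using assms(2,3)
proof (induction k arbitrary: f g)
  case 0
  then show ?case using continuous_on_cong[of S S f g] by simp
next
  case (Suc k)
  have "Ck_on k S (partial_deriv i g)" for i
  proof (rule Suc.IH)
    show "partial_deriv i f y = partial_deriv i g y" if "y \<in> S" for y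
      by (rule partial_deriv_cong_open[OF assms(1) that Suc.prems(1)])
    show "Ck_on k S (partial_deriv i f)"
      using Suc.prems(2) by simp
  qed
  moreover have "g differentiable_on S"
    unfolding differentiable_on_def
  proof
    fix x assume "x \<in> S"
    then obtain f' where "(f has_derivative f') (at x within S)"
      using Suc.prems(2) by (auto simp: differentiable_on_def differentiable_def)
    then show "g differentiable (at x within S)"
      unfolding differentiable_def
      by (metis has_derivative_transform[OF \<open>x \<in> S\<close>] Suc.prems(1))
  qed
  ultimately show ?case by simp
qed

text \<open>Rules of differentiation identify a partial derivative only at points of \<open>S\<close>; since \<open>S\<close> is open,
  that is enough for its higher derivatives on \<open>S\<close>.\<close>

lemma Ck_on_SucI:
  assumes "open S" "\<And>x. x \<in> S \<Longrightarrow> f differentiable (at x)"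
    and "\<And>i x. x \<in> S \<Longrightarrow> partial_deriv i f x = F i x" "\<And>i. Ck_on k S (F i)"
  shows "Ck_on (Suc k) S f"
proof -
  have "f differentiable_on S"
    using assms(2) by (auto simp: differentiable_on_def intro: differentiable_at_withinI)
  moreover have "Ck_on k S (partial_deriv i f)" for i
    by (rule Ck_on_cong_open[OF assms(1) _ assms(4)]) (rule assms(3)[symmetric])
  ultimately show ?thesis by simp
qed

lemma Ck_on_Suc_differentiable:
  "open S \<Longrightarrow> Ck_on (Suc k) S f \<Longrightarrow> x \<in> S \<Longrightarrow> f differentiable (at x)"
  using differentiable_on_eq_differentiable_at[of S f] unfolding Ck_on.simps by blast

lemma Ck_on_SucD: "Ck_on (Suc k) S f \<Longrightarrow> Ck_on k S f"
proof (induction k arbitrary: f)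
  case 0
  then show ?case unfolding Ck_on.simps by (blast intro: differentiable_imp_continuous_on)
next
  case (Suc k)
  then show ?case unfolding Ck_on.simps by blast
qed

lemma Ck_on_const: "Ck_on k S (\<lambda>x. c)"
  by (induction k arbitrary: c) auto

lemma Ck_on_add:
  assumes "open S" "Ck_on k S f" "Ck_on k S g"
  shows "Ck_on k S (\<lambda>x. f x + g x)"
  using assms(2,3)
proof (induction k arbitrary: f g)
  case 0
  then show ?case by (auto intro: continuous_on_add)
next
  case (Suc k)
  note d = Suc.prems[THEN Ck_on_Suc_differentiable[OF assms(1)]]
  show ?case
  proof (rule Ck_on_SucI[OF assms(1)])
    show "Ck_on k S (\<lambda>x. partial_deriv i f x + partial_deriv i g x)" for i
      using Suc.prems by (intro Suc.IH) auto
    show "(\<lambda>x. f x + g x) differentiable (at x)" if "x \<in> S" for x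
      by (intro differentiable_add d that)
    show "partial_deriv i (\<lambda>x. f x + g x) x = partial_deriv i f x + partial_deriv i g x" if "x \<in> S" for i x
      by (intro partial_deriv_add d that)
  qed
qed

lemma Ck_on_mult:
  assumes "open S" "Ck_on k S f" "Ck_on k S g"
  shows "Ck_on k S (\<lambda>x. f x * g x)"
  using assms(2,3)
proof (induction k arbitrary: f g)
  case 0
  then show ?case by (auto intro: continuous_on_mult)
next
  case (Suc k)
  note d = Suc.prems[THEN Ck_on_Suc_differentiable[OF assms(1)]]
  show ?case
  proof (rule Ck_on_SucI[OF assms(1)])
    show "Ck_on k S (\<lambda>x. partial_deriv i f x * g x + f x * partial_deriv i g x)" for i
      using Suc.prems Suc.prems[THEN Ck_on_SucD] by (intro Ck_on_add[OF assms(1)] Suc.IH) auto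
    show "(\<lambda>x. f x * g x) differentiable (at x)" if "x \<in> S" for x
      by (intro differentiable_mult d that)
    show "partial_deriv i (\<lambda>x. f x * g x) x = partial_deriv i f x * g x + f x * partial_deriv i g x" if "x \<in> S" for i x
      by (intro partial_deriv_mult d that)
  qed
qed

lemma Ck_on_inverse:
  assumes "open S" "Ck_on k S f" "\<And>x. x \<in> S \<Longrightarrow> f x \<noteq> 0"
  shows "Ck_on k S (\<lambda>x. inverse (f x))"
  using assms(2)
proof (induction k)
  case 0
  then show ?case using assms(3) by (auto intro: continuous_on_inverse)
next
  case (Suc k)
  note d = Suc.prems[THEN Ck_on_Suc_differentiable[OF assms(1)]]
  show ?case
  proof (rule Ck_on_SucI[OF assms(1)])
    show "Ck_on k S (\<lambda>x. - 1 * (partial_deriv i f x * (inverse (f x) * inverse (f x))))" for i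
      using Suc.prems Suc.IH[OF Ck_on_SucD[OF Suc.prems]]
      by (intro Ck_on_mult[OF assms(1)] Ck_on_const) auto
    show "(\<lambda>x. inverse (f x)) differentiable (at x)" if "x \<in> S" for x
      by (intro differentiable_inverse d assms(3) that)
    show "partial_deriv i (\<lambda>x. inverse (f x)) x
        = - 1 * (partial_deriv i f x * (inverse (f x) * inverse (f x)))" if "x \<in> S" for i x
      by (intro partial_deriv_inverse d assms(3) that)
  qed
qed

lemma Ck_on_compose:
  fixes h :: "real \<Rightarrow> real"
  assumes "open S" "Ck_on k S f" "\<And>j y. (deriv ^^ j) h differentiable (at y)"
  shows "Ck_on k S (\<lambda>x. h (f x))"
  using assms(2,3)
proof (induction k arbitrary: h)
  case 0
  have "continuous_on UNIV h"
    using 0(2)[of 0] by (auto intro!: continuous_at_imp_continuous_on differentiable_imp_continuous_within)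
  from continuous_on_compose2[OF this] 0 show ?case by simp
next
  case (Suc k)
  note d = Suc.prems(1)[THEN Ck_on_Suc_differentiable[OF assms(1)]]
  have h: "h differentiable (at y)" for y using Suc.prems(2)[of 0] by simp
  have "(deriv ^^ j) (deriv h) differentiable (at y)" for j y
    using Suc.prems(2)[of "Suc j" y] by (simp add: funpow_swap1)
  then have "Ck_on k S (\<lambda>x. deriv h (f x))"
    by (rule Suc.IH[OF Ck_on_SucD[OF Suc.prems(1)]])
  show ?case
  proof (rule Ck_on_SucI[OF assms(1)])
    show "Ck_on k S (\<lambda>x. deriv h (f x) * partial_deriv i f x)" for i
      using Suc.prems(1) by (intro Ck_on_mult[OF assms(1)] \<open>Ck_on k S (\<lambda>x. deriv h (f x))\<close>) auto
    show "(\<lambda>x. h (f x)) differentiable (at x)" if "x \<in> S" for x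
      using differentiable_chain_at[OF d[OF that] h] by (simp add: o_def)
    show "partial_deriv i (\<lambda>x. h (f x)) x = deriv h (f x) * partial_deriv i f x" if "x \<in> S" for i x
      by (rule partial_deriv_compose[OF d[OF that] h])
  qed
qed

lemma Ck_on_subset:
  assumes "Ck_on k S f" "T \<subseteq> S"
  shows "Ck_on k T f"
  using assms(1)
  by (induction k arbitrary: f)
     (use assms(2) in \<open>auto intro: continuous_on_subset differentiable_on_subset\<close>)

lemma Ck_on_nth: "Ck_on k S (\<lambda>x. x $ i)"
proof (cases k)
  case 0
  then show ?thesis by (simp add: continuous_on_component)
next
  case (Suc l)
  have "partial_deriv j (\<lambda>x. x $ i) x = axis j 1 $ i" for j and x :: "real ^ 'a"
    unfolding partial_deriv_def
    by (rule DERIV_imp_deriv) (auto intro!: derivative_eq_intros)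
  then have "partial_deriv j (\<lambda>x. x $ i) = (\<lambda>x::real^'a. axis j 1 $ i)" for j by auto
  moreover have "(\<lambda>x::real^'a. x $ i) differentiable_on S"
    by (simp add: bounded_linear_vec_nth bounded_linear_imp_differentiable_on)
  ultimately show ?thesis using Suc by (simp add: Ck_on_const)
qed

definition smooth_on :: "(real ^ 'n) set \<Rightarrow> (real ^ 'n \<Rightarrow> real) \<Rightarrow> bool" where
  "smooth_on S f \<longleftrightarrow> (\<forall>k. Ck_on k S f)"

lemma smooth_on_partial_deriv: "smooth_on S f \<Longrightarrow> smooth_on S (partial_deriv i f)"
  unfolding smooth_on_def by (metis Ck_on.simps(2))

lemma smooth_on_differentiable:
  assumes "smooth_on S f" "open S" "x \<in> S"
  shows "f differentiable (at x)"
proof -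
  have "Ck_on (Suc 0) S f" using assms(1) unfolding smooth_on_def by blast
  then show ?thesis using assms(2,3) by (simp add: differentiable_on_eq_differentiable_at)
qed

lemma smooth_on_continuous_on: "smooth_on S f \<Longrightarrow> continuous_on S f"
  unfolding smooth_on_def by (metis Ck_on.simps(1))

lemma smooth_on_const: "smooth_on S (\<lambda>x. c)"
  and smooth_on_nth: "smooth_on S (\<lambda>x. x $ i)"
  and smooth_on_add: "open S \<Longrightarrow> smooth_on S f \<Longrightarrow> smooth_on S g \<Longrightarrow> smooth_on S (\<lambda>x. f x + g x)"
  and smooth_on_mult: "open S \<Longrightarrow> smooth_on S f \<Longrightarrow> smooth_on S g \<Longrightarrow> smooth_on S (\<lambda>x. f x * g x)"
  and smooth_on_inverse: "open S \<Longrightarrow> smooth_on S f \<Longrightarrow> (\<And>x. x \<in> S \<Longrightarrow> f x \<noteq> 0)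
         \<Longrightarrow> smooth_on S (\<lambda>x. inverse (f x))"
  and smooth_on_cong: "open S \<Longrightarrow> (\<And>x. x \<in> S \<Longrightarrow> f x = g x) \<Longrightarrow> smooth_on S f \<Longrightarrow> smooth_on S g"
  and smooth_on_subset: "smooth_on S f \<Longrightarrow> T \<subseteq> S \<Longrightarrow> smooth_on T f"
  unfolding smooth_on_def
  by (blast intro: Ck_on_const Ck_on_nth Ck_on_add Ck_on_mult Ck_on_inverse Ck_on_cong_open Ck_on_subset)+

lemma smooth_on_diff:
  assumes "open S" "smooth_on S f" "smooth_on S g"
  shows "smooth_on S (\<lambda>x. f x - g x)"
  using smooth_on_add[OF assms(1,2) smooth_on_mult[OF assms(1) smooth_on_const[of S "-1"] assms(3)]]
  by simp

lemma smooth_on_sum: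
  "finite I \<Longrightarrow> open S \<Longrightarrow> (\<And>i. i \<in> I \<Longrightarrow> smooth_on S (f i)) \<Longrightarrow> smooth_on S (\<lambda>x. \<Sum>i\<in>I. f i x)"
proof (induction I rule: finite_induct)
  case empty
  show ?case by (simp add: smooth_on_const)
next
  case (insert j I)
  have "smooth_on S (\<lambda>x. f j x + (\<Sum>i\<in>I. f i x))"
    by (intro smooth_on_add insert) auto
  with insert.hyps show ?case by simp
qed

section \<open>Iterated partial derivatives and the Leibniz rule\<close>

definition iter_pd :: "'n list \<Rightarrow> (real ^ 'n \<Rightarrow> real) \<Rightarrow> real ^ 'n \<Rightarrow> real" where
  "iter_pd is = foldr partial_deriv is"

lemma iter_pd_Nil [simp]: "iter_pd [] f = f"
  and iter_pd_Cons [simp]: "iter_pd (i # is) f = partial_deriv i (iter_pd is f)"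
  by (simp_all add: iter_pd_def)

lemma smooth_on_iter_pd: "smooth_on S f \<Longrightarrow> smooth_on S (iter_pd is f)"
  by (induction "is") (auto intro: smooth_on_partial_deriv)

lemma iter_pd_const: "iter_pd is (\<lambda>x. c) = (\<lambda>x. if is = [] then c else 0)"
  by (induction "is") simp_all

lemma iter_pd_cong_open:
  assumes "open S" "x \<in> S" "\<And>y. y \<in> S \<Longrightarrow> f y = g y"
  shows "iter_pd is f x = iter_pd is g x"
  using assms(2)
  by (induction "is" arbitrary: x) (auto simp: assms(3) intro: partial_deriv_cong_open[OF assms(1)])

lemma iter_pd_add:
  assumes "open S" "smooth_on S f" "smooth_on S g" "x \<in> S"
  shows "iter_pd is (\<lambda>x. f x + g x) x = iter_pd is f x + iter_pd is g x"
  using assms(4)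
proof (induction "is" arbitrary: x)
  case (Cons i "is")
  have "iter_pd (i # is) (\<lambda>x. f x + g x) x
      = partial_deriv i (\<lambda>x. iter_pd is f x + iter_pd is g x) x"
    by (simp, rule partial_deriv_cong_open[OF assms(1) Cons.prems]) (rule Cons.IH)
  also have "\<dots> = iter_pd (i # is) f x + iter_pd (i # is) g x"
    using assms Cons.prems
    by (simp add: partial_deriv_add smooth_on_differentiable[OF smooth_on_iter_pd])
  finally show ?case .
qed simp

lemma partial_deriv_sum_list:
  assumes "\<And>p. p \<in> set ps \<Longrightarrow> F p differentiable (at x)"
  shows "(\<lambda>x. \<Sum>p\<leftarrow>ps. F p x) differentiable (at x)
       \<and> partial_deriv i (\<lambda>x. \<Sum>p\<leftarrow>ps. F p x) x = (\<Sum>p\<leftarrow>ps. partial_deriv i (F p) x)"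
  using assms by (induction ps) (auto simp: partial_deriv_add)

text \<open>The term in which every derivative falls on \<open>g\<close> is split off: in the remaining terms \<open>g\<close> is
  differentiated strictly less often, which drives the induction for reciprocals. The list \<open>ps\<close>
  depends on \<open>is\<close> only, so that one expansion serves all members of a net.\<close>

lemma leibniz:
  obtains ps where
    "\<And>js ks. (js, ks) \<in> set ps \<Longrightarrow> subseq js is \<and> subseq ks is \<and> length ks < length is"
    "\<And>S f g x. \<lbrakk>open S; smooth_on S f; smooth_on S g; x \<in> S\<rbrakk> \<Longrightarrow>
       iter_pd is (\<lambda>x. f x * g x) x
         = f x * iter_pd is g x + (\<Sum>(js, ks)\<leftarrow>ps. iter_pd js f x * iter_pd ks g x)"
proof -
  have "\<exists>ps. (\<forall>(js, ks)\<in>set ps. subseq js is \<and> subseq ks is \<and> length ks < length is) \<and>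
    (\<forall>S f g x. open S \<longrightarrow> smooth_on S f \<longrightarrow> smooth_on S g \<longrightarrow> x \<in> S \<longrightarrow>
       iter_pd is (\<lambda>x. f x * g x) x
         = f x * iter_pd is g x + (\<Sum>(js, ks)\<leftarrow>ps. iter_pd js f x * iter_pd ks g x))"
  proof (induction "is")
    case Nil
    show ?case by (rule exI[of _ "[]"]) simp
  next
    case (Cons i "is")
    then obtain ps where
      ps: "\<And>js ks. (js, ks) \<in> set ps \<Longrightarrow> subseq js is \<and> subseq ks is \<and> length ks < length is"
      and eq: "\<And>S f g x. \<lbrakk>open S; smooth_on S f; smooth_on S g; x \<in> S\<rbrakk> \<Longrightarrow>
       iter_pd is (\<lambda>x. f x * g x) x
         = f x * iter_pd is g x + (\<Sum>(js, ks)\<leftarrow>ps. iter_pd js f x * iter_pd ks g x)"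
      by fastforce
    \<comment> \<open>Differentiating the isolated term \<open>f * iter_pd is g\<close> gives the new isolated term and
      \<open>([i], is)\<close>; every other term splits into two.\<close>
    define qs where
      "qs = ([i], is) # map (\<lambda>(js, ks). (i # js, ks)) ps @ map (\<lambda>(js, ks). (js, i # ks)) ps"
    have "subseq js (i # is) \<and> subseq ks (i # is) \<and> length ks < length (i # is)"
      if "(js, ks) \<in> set qs" for js ks
      using that ps unfolding qs_def by (fastforce simp: list_emb.intros intro: subseq_Cons')
    moreover have "iter_pd (i # is) (\<lambda>x. f x * g x) x
        = f x * iter_pd (i # is) g x + (\<Sum>(js, ks)\<leftarrow>qs. iter_pd js f x * iter_pd ks g x)"
      if S: "open S" "x \<in> S" and fg: "smooth_on S f" "smooth_on S g" for S f g x
    proof -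
      have d: "iter_pd js f differentiable (at x)" "iter_pd js g differentiable (at x)" for js
        using fg S by (auto intro: smooth_on_differentiable smooth_on_iter_pd)
      have f: "f differentiable (at x)" using d(1)[of "[]"] by simp
      define P where "P = (\<lambda>p x. iter_pd (fst p) f x * iter_pd (snd p) g x)"
      have P: "P p differentiable (at x)" for p
        unfolding P_def by (intro differentiable_mult d)
      note sum = partial_deriv_sum_list[of ps P, OF P]
      have "iter_pd (i # is) (\<lambda>x. f x * g x) x
          = partial_deriv i (\<lambda>x. f x * iter_pd is g x + (\<Sum>p\<leftarrow>ps. P p x)) x"
        by (simp, rule partial_deriv_cong_open[OF S])
           (use eq[OF S(1) fg] in \<open>auto simp: P_def case_prod_unfold\<close>)
      also have "\<dots> = partial_deriv i f x * iter_pd is g x + f x * iter_pd (i # is) g x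
          + (\<Sum>p\<leftarrow>ps. partial_deriv i (P p) x)"
        using f d sum by (simp add: partial_deriv_add partial_deriv_mult)
      also have "(\<Sum>p\<leftarrow>ps. partial_deriv i (P p) x)
          = (\<Sum>p\<leftarrow>ps. iter_pd (i # fst p) f x * iter_pd (snd p) g x
                   + iter_pd (fst p) f x * iter_pd (i # snd p) g x)"
        using d by (simp add: P_def partial_deriv_mult)
      finally show ?thesis
        by (simp add: qs_def sum_list_addf case_prod_unfold o_def)
    qed
    ultimately show ?case by (intro exI[of _ qs]) blast
  qed
  then show thesis using that by fastforce
qed

text \<open>Applied to \<open>f g = 1\<close>, the left side of the Leibniz rule is a constant; solving for the isolated
  term and multiplying by \<open>g = 1 / f\<close> gives a recursion for the derivatives of \<open>g\<close>.\<close>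

lemma leibniz_reciprocal:
  obtains ps where
    "\<And>js ks. (js, ks) \<in> set ps \<Longrightarrow> subseq js is \<and> subseq ks is \<and> length ks < length is"
    "\<And>S f g x. \<lbrakk>open S; smooth_on S f; smooth_on S g; \<And>y. y \<in> S \<Longrightarrow> f y * g y = 1; x \<in> S\<rbrakk> \<Longrightarrow>
       iter_pd is g x
         = g x * ((if is = [] then 1 else 0) - (\<Sum>(js, ks)\<leftarrow>ps. iter_pd js f x * iter_pd ks g x))"
proof -
  obtain ps where
    ps: "\<And>js ks. (js, ks) \<in> set ps \<Longrightarrow> subseq js is \<and> subseq ks is \<and> length ks < length is"
    and eq: "\<And>S f g x. \<lbrakk>open S; smooth_on S f; smooth_on S g; x \<in> S\<rbrakk> \<Longrightarrow>
       iter_pd is (\<lambda>x. f x * g x) x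
         = f x * iter_pd is g x + (\<Sum>(js, ks)\<leftarrow>ps. iter_pd js f x * iter_pd ks g x)"
    by (rule leibniz[of "is"]) blast
  have "iter_pd is g x
      = g x * ((if is = [] then 1 else 0) - (\<Sum>(js, ks)\<leftarrow>ps. iter_pd js f x * iter_pd ks g x))"
    if S: "open S" "x \<in> S" and fg: "smooth_on S f" "smooth_on S g"
      and 1: "\<And>y. y \<in> S \<Longrightarrow> f y * g y = 1" for S f g x
  proof -
    have "iter_pd is (\<lambda>x. f x * g x) x = iter_pd is (\<lambda>x. 1) x"
      by (rule iter_pd_cong_open[OF S 1])
    then have "(if is = [] then 1 else 0) - (\<Sum>(js, ks)\<leftarrow>ps. iter_pd js f x * iter_pd ks g x)
        = f x * iter_pd is g x"
      using eq[OF S(1) fg S(2)] by (simp add: iter_pd_const)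
    then have "g x * ((if is = [] then 1 else 0) - (\<Sum>(js, ks)\<leftarrow>ps. iter_pd js f x * iter_pd ks g x))
        = (f x * g x) * iter_pd is g x"
      by simp
    then show ?thesis using 1[OF S(2)] by simp
  qed
  with ps show thesis by (rule that)
qed

text \<open>The lists of derivatives that occur in \<open>multi_deriv\<close>: each coordinate of \<open>xs\<close> is repeated
  as often as the multi-index prescribes.\<close>

definition blocks :: "('n \<Rightarrow> nat) \<Rightarrow> 'n list \<Rightarrow> 'n list" where
  "blocks \<alpha> xs = concat (map (\<lambda>i. replicate (\<alpha> i) i) xs)"

text \<open>A sublist takes fewer repetitions from each block; since no coordinate has two blocks, these
  numbers form a multi-index.\<close>

lemma subseq_blocks:
  assumes "distinct xs" "subseq js (blocks \<alpha> xs)"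
  shows "\<exists>\<beta>. js = blocks \<beta> xs"
  using assms
proof (induction xs arbitrary: js)
  case Nil
  then show ?case by (simp add: blocks_def)
next
  case (Cons i xs)
  from Cons.prems(2) have "subseq js (replicate (\<alpha> i) i @ blocks \<alpha> xs)"
    by (simp add: blocks_def)
  then obtain js1 js2 where js: "js = js1 @ js2" "subseq js1 (replicate (\<alpha> i) i)"
    "subseq js2 (blocks \<alpha> xs)"
    by (meson subseq_append_iff)
  from Cons.IH[OF _ js(3)] Cons.prems(1) obtain \<beta> where \<beta>: "js2 = blocks \<beta> xs" by auto
  have "a = i" if "a \<in> set js1" for a
    using list_emb_set[OF js(2) that] by (auto split: if_splits)
  then have "js1 = replicate (length js1) i"
    by (metis replicate_length_same)
  moreover have "blocks \<beta> xs = blocks (\<beta>(i := length js1)) xs"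
    unfolding blocks_def using Cons.prems(1)
    by (intro arg_cong[where f = concat] map_cong) auto
  ultimately have "js = blocks (\<beta>(i := length js1)) (i # xs)"
    using js(1) \<beta> by (simp add: blocks_def)
  then show ?case by blast
qed

definition ordered :: "'n::finite list \<Rightarrow> bool" where
  "ordered is \<longleftrightarrow> (\<exists>\<alpha>. is = blocks \<alpha> coord_list)"

lemma ordered_Nil [simp]: "ordered []"
  unfolding ordered_def by (rule exI[of _ "\<lambda>_. 0"]) (simp add: blocks_def)

lemma ordered_subseq: "ordered is \<Longrightarrow> subseq js is \<Longrightarrow> ordered js"
proof -
  have "distinct (coord_list :: 'a list)"
    unfolding coord_list_def
    by (rule someI2_ex) (use finite_distinct_list[of "UNIV :: 'a set"] in auto)
  then show "ordered is \<Longrightarrow> subseq js is \<Longrightarrow> ordered js"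
    unfolding ordered_def using subseq_blocks by blast
qed

lemma multi_deriv_eq_iter_pd: "multi_deriv \<alpha> = iter_pd (blocks \<alpha> coord_list)"
proof -
  have "foldr partial_deriv (replicate n i) f = (partial_deriv i ^^ n) f"
    for n and i :: 'a and f
    by (induction n) auto
  then have "foldr (\<lambda>i. partial_deriv i ^^ \<alpha> i) xs f = iter_pd (blocks \<alpha> xs) f" for xs f
    by (induction xs) (auto simp: iter_pd_def blocks_def)
  then show ?thesis by (auto simp: multi_deriv_def)
qed

text \<open>Translates statements about all multi-indices into statements about ordered lists, to which
  \<open>leibniz\<close> applies.\<close>

lemma all_multi_deriv_iff: "(\<forall>\<alpha>. P (multi_deriv \<alpha>)) \<longleftrightarrow> (\<forall>is. ordered is \<longrightarrow> P (iter_pd is))"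
  unfolding multi_deriv_eq_iter_pd ordered_def by blast

section \<open>Smooth functions vanishing on a compact set\<close>

definition flat :: "real poly \<Rightarrow> real \<Rightarrow> real" where
  "flat p t = (if t \<le> 0 then 0 else poly p (inverse t) * exp (- inverse t))"

lemma poly_times_exp_minus_tendsto_0:
  "((\<lambda>s. poly p s * exp (- s)) \<longlongrightarrow> (0::real)) at_top"
proof -
  have "((\<lambda>s. \<Sum>i\<le>degree p. coeff p i * (s ^ i / exp s)) \<longlongrightarrow> (\<Sum>i\<le>degree p. coeff p i * 0)) at_top"
    by (intro tendsto_sum tendsto_mult tendsto_const tendsto_power_div_exp_0)
  then show ?thesis
    by (simp add: poly_altdef sum_distrib_right exp_minus divide_inverse mult.assoc)
qed

text \<open>The functions \<open>p (1 / t) exp (- 1 / t)\<close> for \<open>t > 0\<close>, continued by zero, are closed under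
  differentiation, since the exponential beats every power of \<open>1 / t\<close> at \<open>0\<close>. Smoothness of the
  standard flat function follows without computing its derivatives.\<close>

lemma DERIV_flat:
  "(flat p has_real_derivative flat ([:0, 0, 1:] * (p - pderiv p)) t) (at t)"
proof (cases t "0 :: real" rule: linorder_cases)
  case less
  have "(flat p has_real_derivative 0) (at t)"
    by (rule has_field_derivative_transform_within_open[where S = "{..<0}" and f = "\<lambda>_. 0"])
       (use less in \<open>auto simp: flat_def\<close>)
  with less show ?thesis by (simp add: flat_def)
next
  case greater
  have "((\<lambda>t. poly p (inverse t) * exp (- inverse t)) has_real_derivative
      flat ([:0, 0, 1:] * (p - pderiv p)) t) (at t)"
    using greater
    by (auto intro!: derivative_eq_intros DERIV_chain'[OF _ poly_DERIV] simp: flat_def)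
       (simp add: algebra_simps power2_eq_square)
  then show ?thesis
    by (rule has_field_derivative_transform_within_open[where S = "{0<..}"])
       (use greater in \<open>auto simp: flat_def\<close>)
next
  case equal
  have "((\<lambda>y. flat p y / y) \<longlongrightarrow> 0) (at_left 0)"
  proof (rule tendsto_eventually)
    show "\<forall>\<^sub>F y in at_left 0. flat p y / y = 0"
      by (rule eventually_at_leftI[of "-1"]) (auto simp: flat_def)
  qed
  moreover have "((\<lambda>y. flat p y / y) \<longlongrightarrow> 0) (at_right 0)"
  proof (rule Lim_transform_eventually)
    show "((\<lambda>y. poly (pCons 0 p) (inverse y) * exp (- inverse y)) \<longlongrightarrow> 0) (at_right 0)"
      by (rule filterlim_compose[OF poly_times_exp_minus_tendsto_0 filterlim_inverse_at_top_right])
    show "\<forall>\<^sub>F y in at_right 0.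
        poly (pCons 0 p) (inverse y) * exp (- inverse y) = flat p y / y"
      by (rule eventually_at_rightI[of 0 1]) (auto simp: flat_def field_simps)
  qed
  ultimately have "((\<lambda>y. flat p y / y) \<longlongrightarrow> 0) (at 0)"
    by (simp add: filterlim_at_split)
  then show ?thesis
    unfolding equal has_field_derivative_iff by (simp add: flat_def)
qed

lemma flat_smooth: "(deriv ^^ k) (flat p) differentiable (at t)"
proof (induction k arbitrary: p)
  case 0
  show ?case using DERIV_flat[of p t] by (auto simp: real_differentiable_def)
next
  case (Suc k)
  have "deriv (flat p) = flat ([:0, 0, 1:] * (p - pderiv p))"
    using DERIV_flat by (auto intro: DERIV_imp_deriv)
  then show ?case using Suc.IH by (simp add: funpow_swap1)
qed

definition step :: "real \<Rightarrow> real" where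
  "step = flat 1"

lemma step_pos: "0 < t \<Longrightarrow> 0 < step t"
  and step_eq_0: "t \<le> 0 \<Longrightarrow> step t = 0"
  and step_nonneg: "0 \<le> step t"
  by (auto simp: step_def flat_def)

lemma smooth_on_step: "open S \<Longrightarrow> smooth_on S f \<Longrightarrow> smooth_on S (\<lambda>x. step (f x))"
  unfolding smooth_on_def step_def by (blast intro: Ck_on_compose flat_smooth)

text \<open>Finitely many balls inside \<open>W\<close> cover \<open>K\<close>. The sum \<open>s\<close> of bumps supported in them is at least
  some \<open>m > 0\<close> on \<open>K\<close> and vanishes off \<open>W\<close>, so \<open>step (m - s)\<close> has the required properties.\<close>

lemma smooth_vanishing_on_compact:
  fixes K W :: "(real ^ 'n) set"
  assumes "compact K" "open W" "K \<subseteq> W"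
  obtains d where "smooth_on UNIV d" "\<And>x. 0 \<le> d x" "\<And>x. x \<in> K \<Longrightarrow> d x = 0"
    "\<And>x. x \<notin> W \<Longrightarrow> 0 < d x"
proof -
  have "\<forall>x\<in>K. \<exists>r>0. ball x r \<subseteq> W"
    using assms(2,3) openE by blast
  then obtain r where r: "\<And>x. x \<in> K \<Longrightarrow> 0 < r x" "\<And>x. x \<in> K \<Longrightarrow> ball x (r x) \<subseteq> W"
    by metis
  obtain T where T: "T \<subseteq> K" "finite T" "K \<subseteq> (\<Union>c\<in>T. ball c (r c))"
    by (rule compactE_image[OF assms(1), of K "\<lambda>c. ball c (r c)"]) (use r in auto)
  \<comment> \<open>\<open>b c\<close> is positive exactly on the ball around \<open>c\<close>; written in coordinates it is visibly smooth.\<close>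
  define b where "b c x = (r c)\<^sup>2 - (\<Sum>i\<in>UNIV. (x $ i - c $ i) * (x $ i - c $ i))" for c x :: "real ^ 'n"
  have b: "b c x = (r c)\<^sup>2 - (dist c x)\<^sup>2" for c x
    by (simp add: b_def dist_norm power2_norm_eq_inner inner_vec_def algebra_simps)
  have b_pos: "0 < b c x \<longleftrightarrow> x \<in> ball c (r c)" if "c \<in> T" for c x
  proof -
    have "0 < r c" using r(1) that T(1) by blast
    then have "(dist c x)\<^sup>2 < (r c)\<^sup>2 \<longleftrightarrow> dist c x < r c"
      by (metis less_imp_le power2_less_imp_less power_strict_mono zero_le_dist zero_less_numeral)
    then show ?thesis by (simp add: b)
  qed
  define s where "s x = (\<Sum>c\<in>T. step (b c x))" for x
  have s_smooth: "smooth_on UNIV s"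
    unfolding s_def b_def
    by (intro smooth_on_sum smooth_on_step smooth_on_diff smooth_on_mult smooth_on_const
        smooth_on_nth T(2)) auto
  have s_nonneg: "0 \<le> s x" for x
    unfolding s_def by (intro sum_nonneg step_nonneg)
  have s_pos: "0 < s x" if "x \<in> K" for x
  proof -
    obtain c where c: "c \<in> T" "x \<in> ball c (r c)" using T(3) \<open>x \<in> K\<close> by blast
    then have "0 < step (b c x)" using b_pos step_pos by blast
    with c(1) T(2) show ?thesis
      unfolding s_def by (intro sum_pos2[of T c]) (auto intro: step_nonneg)
  qed
  have s_0: "s x = 0" if "x \<notin> W" for x
  proof -
    have "b c x \<le> 0" if "c \<in> T" for c
      using b_pos[OF that, of x] r(2)[of c] T(1) that \<open>x \<notin> W\<close> by force
    then show ?thesis by (simp add: s_def step_eq_0)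
  qed
  obtain m where m: "0 < m" "\<And>x. x \<in> K \<Longrightarrow> m \<le> s x"
  proof (cases "K = {}")
    case True
    then show thesis using that[of 1] by simp
  next
    case False
    then obtain y where "y \<in> K" "\<forall>x\<in>K. s y \<le> s x"
      using continuous_attains_inf[OF assms(1) False, of s]
        continuous_on_subset[OF smooth_on_continuous_on[OF s_smooth]] by blast
    then show thesis using that[of "s y"] s_pos by auto
  qed
  show thesis
  proof (rule that[of "\<lambda>x. step (m - s x)"])
    show "smooth_on UNIV (\<lambda>x. step (m - s x))"
      by (intro smooth_on_step smooth_on_diff smooth_on_const s_smooth) auto
  qed (use m s_0 in \<open>auto simp: step_nonneg step_pos step_eq_0\<close>)
qed

section \<open>Rescaled mollifiers\<close>

lemma test_functions_rescale:
  assumes "\<phi> \<in> test_functions" "0 < \<epsilon>"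
  shows "(\<lambda>x. \<phi> (x / \<epsilon>) / \<epsilon>) \<in> test_functions"
proof -
  have d: "(deriv ^^ k) \<phi> differentiable (at x)" for k x
    using assms(1) by (auto simp: test_functions_def)
  have D: "((\<lambda>x. (deriv ^^ k) \<phi> (x / \<epsilon>) / \<epsilon> ^ Suc k) has_real_derivative
      (deriv ^^ Suc k) \<phi> (x / \<epsilon>) / \<epsilon> ^ Suc (Suc k)) (at x)" for k x
  proof -
    have "((deriv ^^ k) \<phi> has_real_derivative (deriv ^^ Suc k) \<phi> (x / \<epsilon>)) (at (x / \<epsilon>))"
      using d[of k] by (simp add: DERIV_deriv_iff_real_differentiable)
    from DERIV_chain2[OF this DERIV_cdivide[OF DERIV_ident]]
    show ?thesis
      using assms(2) by (auto intro!: derivative_eq_intros simp: field_simps)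
  qed
  have "(deriv ^^ k) (\<lambda>x. \<phi> (x / \<epsilon>) / \<epsilon>) = (\<lambda>x. (deriv ^^ k) \<phi> (x / \<epsilon>) / \<epsilon> ^ Suc k)" for k
  proof (induction k)
    case (Suc k)
    then show ?case using DERIV_imp_deriv[OF D, of k] by (intro ext) (simp add: Suc.IH)
  qed simp
  then have "(deriv ^^ k) (\<lambda>x. \<phi> (x / \<epsilon>) / \<epsilon>) differentiable (at x)" for k x
    using D[of k x] by (auto simp: real_differentiable_def simp del: power_Suc)
  moreover have "compact (closure {x. \<phi> (x / \<epsilon>) / \<epsilon> \<noteq> 0})"
  proof -
    let ?K = "closure {x. \<phi> x \<noteq> 0}"
    have K: "compact ((\<lambda>x. \<epsilon> *\<^sub>R x) ` ?K)"
      using assms(1) by (intro compact_scaling) (simp add: test_functions_def)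
    have "{x. \<phi> (x / \<epsilon>) / \<epsilon> \<noteq> 0} \<subseteq> (\<lambda>x. \<epsilon> *\<^sub>R x) ` ?K"
    proof
      fix x assume "x \<in> {x. \<phi> (x / \<epsilon>) / \<epsilon> \<noteq> 0}"
      then have "x / \<epsilon> \<in> ?K" using closure_subset by fastforce
      then show "x \<in> (\<lambda>x. \<epsilon> *\<^sub>R x) ` ?K" using assms(2) by (auto intro!: image_eqI[of _ _ "x / \<epsilon>"])
    qed
    then show ?thesis
      using K by (meson compact_closure bounded_subset compact_imp_bounded)
  qed
  ultimately show ?thesis by (simp add: test_functions_def)
qed

lemma integral_rescale:
  fixes \<phi> :: "real \<Rightarrow> real"
  assumes "0 < \<epsilon>"
  shows "(LBINT x. x ^ k * (\<phi> (x / \<epsilon>) / \<epsilon>)) = \<epsilon> ^ k * (LBINT x. x ^ k * \<phi> x)"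
proof -
  have "(LBINT x. x ^ k * (\<phi> (x / \<epsilon>) / \<epsilon>))
      = \<bar>\<epsilon>\<bar> *\<^sub>R (LBINT x. (0 + \<epsilon> * x) ^ k * (\<phi> ((0 + \<epsilon> * x) / \<epsilon>) / \<epsilon>))"
    by (rule lborel_integral_real_affine) (use assms in simp)
  also have "(\<lambda>x. (0 + \<epsilon> * x) ^ k * (\<phi> ((0 + \<epsilon> * x) / \<epsilon>) / \<epsilon>))
      = (\<lambda>x. (\<epsilon> ^ k / \<epsilon>) * (x ^ k * \<phi> x))"
    using assms by (simp add: fun_eq_iff power_mult_distrib field_simps)
  finally show ?thesis using assms by simp
qed

lemma rescale_mollifiers:
  assumes "\<phi> \<in> mollifiers q" "0 < \<epsilon>"
  shows "rescale \<epsilon> \<phi> \<in> mollifiers q"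
proof -
  obtain \<phi>0 where \<phi>0: "\<phi>0 \<in> mollifiers_1d q" "\<phi> = (\<lambda>x. \<Prod>i\<in>UNIV. \<phi>0 (x $ i))"
    using assms(1) by (auto simp: mollifiers_def)
  have "(\<lambda>x. \<phi>0 (x / \<epsilon>) / \<epsilon>) \<in> mollifiers_1d q"
    using \<phi>0(1) test_functions_rescale[OF _ assms(2)] integral_rescale[OF assms(2), of _ \<phi>0]
      integral_rescale[OF assms(2), of 0 \<phi>0]
    by (simp add: mollifiers_1d_def)
  moreover have "rescale \<epsilon> \<phi> = (\<lambda>x. \<Prod>i\<in>UNIV. \<phi>0 (x $ i / \<epsilon>) / \<epsilon>)"
    by (simp add: rescale_def \<phi>0(2) prod_dividef divide_inverse mult.commute prod.distrib power_inverse)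
  ultimately show ?thesis by (auto simp: mollifiers_def)
qed

lemma mollifiers_antimono: "\<phi> \<in> mollifiers q \<Longrightarrow> p \<le> q \<Longrightarrow> \<phi> \<in> mollifiers p"
  by (force simp: mollifiers_def mollifiers_1d_def)

section \<open>Growth in the scaling parameter\<close>

text \<open>The asymptotic conditions of moderate and negligible nets, for one derivative \<open>a \<psi> x\<close> at the
  points of one set \<open>S\<close>. The constant factor is absorbed into the power of \<open>\<epsilon>\<close>, see
  \<open>moderate_onI\<close> and \<open>negligible_onI\<close>.\<close>

definition moderate_on :: "(real ^ 'n) set \<Rightarrow> ((real ^ 'n \<Rightarrow> real) \<Rightarrow> real ^ 'n \<Rightarrow> real) \<Rightarrow> bool" where
  "moderate_on S a \<longleftrightarrow> (\<exists>N. \<forall>\<phi>\<in>mollifiers N. \<forall>\<^sub>F \<epsilon> in at_right 0.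
     \<forall>x\<in>S. \<bar>a (rescale \<epsilon> \<phi>) x\<bar> \<le> 1 / \<epsilon> ^ N)"

definition negligible_on :: "(real ^ 'n) set \<Rightarrow> ((real ^ 'n \<Rightarrow> real) \<Rightarrow> real ^ 'n \<Rightarrow> real) \<Rightarrow> bool" where
  "negligible_on S a \<longleftrightarrow> (\<exists>N. \<forall>q\<ge>N. \<forall>\<phi>\<in>mollifiers q. \<forall>\<^sub>F \<epsilon> in at_right 0.
     \<forall>x\<in>S. \<bar>a (rescale \<epsilon> \<phi>) x\<bar> \<le> \<epsilon> ^ (q - N))"

lemma moderate_onE:
  assumes "moderate_on S a"
  obtains N where "\<And>\<phi>. \<phi> \<in> mollifiers N \<Longrightarrow>
    \<forall>\<^sub>F \<epsilon> in at_right 0. \<forall>x\<in>S. \<bar>a (rescale \<epsilon> \<phi>) x\<bar> \<le> 1 / \<epsilon> ^ N"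
  using assms unfolding moderate_on_def by blast

lemma negligible_onE:
  assumes "negligible_on S a"
  obtains N where "\<And>q \<phi>. N \<le> q \<Longrightarrow> \<phi> \<in> mollifiers q \<Longrightarrow>
    \<forall>\<^sub>F \<epsilon> in at_right 0. \<forall>x\<in>S. \<bar>a (rescale \<epsilon> \<phi>) x\<bar> \<le> \<epsilon> ^ (q - N)"
  using assms unfolding negligible_on_def by blast

lemma ex_eta_iff:
  "(\<exists>\<eta>>0. \<forall>\<epsilon>. 0 < \<epsilon> \<and> \<epsilon> < \<eta> \<longrightarrow> P \<epsilon>) \<longleftrightarrow> (\<forall>\<^sub>F \<epsilon> in at_right (0 :: real). P \<epsilon>)"
  unfolding eventually_at_right_field by blast

lemma eventually_small: "\<forall>\<^sub>F \<epsilon> in at_right (0 :: real). 0 < \<epsilon> \<and> \<epsilon> < 1 \<and> c * \<epsilon> \<le> 1"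
proof (rule eventually_at_rightI)
  fix \<epsilon> assume "\<epsilon> \<in> {0<..<1 / (\<bar>c\<bar> + 1)}"
  then have e: "0 < \<epsilon>" "(\<bar>c\<bar> + 1) * \<epsilon> < 1"
    by (auto simp: pos_less_divide_eq mult.commute)
  have "c * \<epsilon> \<le> \<bar>c\<bar> * \<epsilon>" "0 \<le> \<bar>c\<bar> * \<epsilon>" using e(1) by (auto intro: mult_right_mono)
  moreover have "(\<bar>c\<bar> + 1) * \<epsilon> = \<bar>c\<bar> * \<epsilon> + \<epsilon>" by (simp add: algebra_simps)
  ultimately show "0 < \<epsilon> \<and> \<epsilon> < 1 \<and> c * \<epsilon> \<le> 1" using e by linarith
qed auto

lemma eventually_rescale_mollifiers:
  assumes "\<phi> \<in> mollifiers q"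
  shows "\<forall>\<^sub>F \<epsilon> in at_right 0. rescale \<epsilon> \<phi> \<in> mollifiers 0"
  by (rule eventually_mono[OF eventually_small[of 0]])
     (use rescale_mollifiers[OF assms] mollifiers_antimono[where p = 0] in auto)

text \<open>A constant costs one power of \<open>\<epsilon>\<close>, and the sets of mollifiers shrink as their index grows, so \<open>N\<close> may be
  replaced by \<open>Suc N\<close>.\<close>

lemma moderate_onI:
  assumes "\<And>\<phi>. \<phi> \<in> mollifiers N \<Longrightarrow>
    \<exists>c. \<forall>\<^sub>F \<epsilon> in at_right 0. \<forall>x\<in>S. \<bar>a (rescale \<epsilon> \<phi>) x\<bar> \<le> c / \<epsilon> ^ N"
  shows "moderate_on S a"
  unfolding moderate_on_def
proof (intro exI ballI)
  fix \<phi> :: "real ^ 'a \<Rightarrow> real" assume "\<phi> \<in> mollifiers (Suc N)"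
  then have "\<phi> \<in> mollifiers N" by (rule mollifiers_antimono) simp
  then obtain c where "\<forall>\<^sub>F \<epsilon> in at_right 0. \<forall>x\<in>S. \<bar>a (rescale \<epsilon> \<phi>) x\<bar> \<le> c / \<epsilon> ^ N"
    using assms by blast
  then show "\<forall>\<^sub>F \<epsilon> in at_right 0. \<forall>x\<in>S. \<bar>a (rescale \<epsilon> \<phi>) x\<bar> \<le> 1 / \<epsilon> ^ Suc N"
    using eventually_small[of c]
  proof eventually_elim
    case (elim \<epsilon>)
    then have "c / \<epsilon> ^ N \<le> 1 / \<epsilon> ^ Suc N" by (simp add: field_simps)
    with elim show ?case by (meson order_trans)
  qed
qed

lemma negligible_onI:
  assumes "\<And>q \<phi>. N \<le> q \<Longrightarrow> \<phi> \<in> mollifiers q \<Longrightarrow>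
    \<exists>c. \<forall>\<^sub>F \<epsilon> in at_right 0. \<forall>x\<in>S. \<bar>a (rescale \<epsilon> \<phi>) x\<bar> \<le> c * \<epsilon> ^ (q - N)"
  shows "negligible_on S a"
  unfolding negligible_on_def
proof (intro exI ballI allI impI)
  fix q and \<phi> :: "real ^ 'a \<Rightarrow> real" assume q: "Suc N \<le> q" and "\<phi> \<in> mollifiers q"
  then obtain c where "\<forall>\<^sub>F \<epsilon> in at_right 0. \<forall>x\<in>S. \<bar>a (rescale \<epsilon> \<phi>) x\<bar> \<le> c * \<epsilon> ^ (q - N)"
    using assms[of q \<phi>] by auto
  then show "\<forall>\<^sub>F \<epsilon> in at_right 0. \<forall>x\<in>S. \<bar>a (rescale \<epsilon> \<phi>) x\<bar> \<le> \<epsilon> ^ (q - Suc N)"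
    using eventually_small[of c]
  proof eventually_elim
    case (elim \<epsilon>)
    have "q - N = Suc (q - Suc N)" using q by simp
    then have "c * \<epsilon> ^ (q - N) = (c * \<epsilon>) * \<epsilon> ^ (q - Suc N)" by simp
    also have "\<dots> \<le> 1 * \<epsilon> ^ (q - Suc N)"
      using elim by (intro mult_right_mono) auto
    finally have "c * \<epsilon> ^ (q - N) \<le> \<epsilon> ^ (q - Suc N)" by simp
    with elim show ?case by (meson order_trans)
  qed
qed

lemma inverse_power_mono:
  fixes \<epsilon> :: real
  assumes "0 < \<epsilon>" "\<epsilon> < 1" "M \<le> N"
  shows "1 / \<epsilon> ^ M \<le> 1 / \<epsilon> ^ N"
  using assms by (intro divide_left_mono power_decreasing) auto

text \<open>Values matter only at \<open>\<phi>\<^sub>\<epsilon>\<close> with \<open>\<phi>\<close> having many vanishing moments and \<open>\<epsilon>\<close> small. This is what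
  allows an inverse to be modified away from a compact set.\<close>

lemma moderate_on_eventually_eq:
  assumes "moderate_on S a"
    and "\<And>\<phi>. \<phi> \<in> mollifiers p \<Longrightarrow>
      \<forall>\<^sub>F \<epsilon> in at_right 0. \<forall>x\<in>S. b (rescale \<epsilon> \<phi>) x = a (rescale \<epsilon> \<phi>) x"
  shows "moderate_on S b"
proof -
  obtain N where N: "\<And>\<phi>. \<phi> \<in> mollifiers N \<Longrightarrow>
      \<forall>\<^sub>F \<epsilon> in at_right 0. \<forall>x\<in>S. \<bar>a (rescale \<epsilon> \<phi>) x\<bar> \<le> 1 / \<epsilon> ^ N"
    by (rule moderate_onE[OF assms(1)]) blast
  show ?thesis
  proof (rule moderate_onI[where N = "N + p"], rule exI[where x = 1])
    fix \<phi> :: "real ^ 'a \<Rightarrow> real" assume "\<phi> \<in> mollifiers (N + p)"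
    then have "\<phi> \<in> mollifiers N" "\<phi> \<in> mollifiers p"
      by (auto elim: mollifiers_antimono)
    from N[OF this(1)] assms(2)[OF this(2)] eventually_small[of 0]
    show "\<forall>\<^sub>F \<epsilon> in at_right 0. \<forall>x\<in>S. \<bar>b (rescale \<epsilon> \<phi>) x\<bar> \<le> 1 / \<epsilon> ^ (N + p)"
    proof eventually_elim
      case (elim \<epsilon>)
      then have "1 / \<epsilon> ^ N \<le> 1 / \<epsilon> ^ (N + p)" by (intro inverse_power_mono) auto
      with elim show ?case by (metis order_trans)
    qed
  qed
qed

lemma negligible_on_eventually_eq:
  assumes "negligible_on S a"
    and "\<And>\<phi>. \<phi> \<in> mollifiers p \<Longrightarrow>
      \<forall>\<^sub>F \<epsilon> in at_right 0. \<forall>x\<in>S. b (rescale \<epsilon> \<phi>) x = a (rescale \<epsilon> \<phi>) x"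
  shows "negligible_on S b"
proof -
  obtain N where N: "\<And>q \<phi>. N \<le> q \<Longrightarrow> \<phi> \<in> mollifiers q \<Longrightarrow>
      \<forall>\<^sub>F \<epsilon> in at_right 0. \<forall>x\<in>S. \<bar>a (rescale \<epsilon> \<phi>) x\<bar> \<le> \<epsilon> ^ (q - N)"
    by (rule negligible_onE[OF assms(1)]) blast
  show ?thesis
  proof (rule negligible_onI[where N = "N + p"], rule exI[where x = 1])
    fix q and \<phi> :: "real ^ 'a \<Rightarrow> real" assume q: "N + p \<le> q" and \<phi>: "\<phi> \<in> mollifiers q"
    then have "\<phi> \<in> mollifiers p" using q by (elim mollifiers_antimono) simp
    have "N \<le> q" using q by simp
    from N[OF this \<phi>] assms(2)[OF \<open>\<phi> \<in> mollifiers p\<close>] eventually_small[of 0]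
    show "\<forall>\<^sub>F \<epsilon> in at_right 0. \<forall>x\<in>S. \<bar>b (rescale \<epsilon> \<phi>) x\<bar> \<le> 1 * \<epsilon> ^ (q - (N + p))"
    proof eventually_elim
      case (elim \<epsilon>)
      then have "\<epsilon> ^ (q - N) \<le> \<epsilon> ^ (q - (N + p))" by (intro power_decreasing) auto
      with elim show ?case by (metis order_trans mult_1)
    qed
  qed
qed

lemma moderate_on_cong:
  assumes "\<And>\<psi> x. \<psi> \<in> mollifiers 0 \<Longrightarrow> x \<in> S \<Longrightarrow> b \<psi> x = a \<psi> x" "moderate_on S a"
  shows "moderate_on S b"
proof (rule moderate_on_eventually_eq[OF assms(2), where p = 0])
  fix \<phi> :: "real ^ 'a \<Rightarrow> real" assume "\<phi> \<in> mollifiers 0"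
  from eventually_rescale_mollifiers[OF this]
  show "\<forall>\<^sub>F \<epsilon> in at_right 0. \<forall>x\<in>S. b (rescale \<epsilon> \<phi>) x = a (rescale \<epsilon> \<phi>) x"
    by eventually_elim (use assms(1) in blast)
qed

lemma negligible_on_cong:
  assumes "\<And>\<psi> x. \<psi> \<in> mollifiers 0 \<Longrightarrow> x \<in> S \<Longrightarrow> b \<psi> x = a \<psi> x" "negligible_on S a"
  shows "negligible_on S b"
proof (rule negligible_on_eventually_eq[OF assms(2), where p = 0])
  fix \<phi> :: "real ^ 'a \<Rightarrow> real" assume "\<phi> \<in> mollifiers 0"
  from eventually_rescale_mollifiers[OF this]
  show "\<forall>\<^sub>F \<epsilon> in at_right 0. \<forall>x\<in>S. b (rescale \<epsilon> \<phi>) x = a (rescale \<epsilon> \<phi>) x"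
    by eventually_elim (use assms(1) in blast)
qed

lemma moderate_on_const: "moderate_on S (\<lambda>\<psi> x. c)"
  by (rule moderate_onI[where N = 0], rule exI[of _ "\<bar>c\<bar>"]) simp

lemma negligible_on_0: "negligible_on S (\<lambda>\<psi> x. 0)"
  by (rule negligible_onI[where N = 0], rule exI[of _ 0]) simp

lemma moderate_on_add:
  assumes "moderate_on S a" "moderate_on S b"
  shows "moderate_on S (\<lambda>\<psi> x. a \<psi> x + b \<psi> x)"
proof -
  obtain M where M: "\<And>\<phi>. \<phi> \<in> mollifiers M \<Longrightarrow>
      \<forall>\<^sub>F \<epsilon> in at_right 0. \<forall>x\<in>S. \<bar>a (rescale \<epsilon> \<phi>) x\<bar> \<le> 1 / \<epsilon> ^ M"
    by (rule moderate_onE[OF assms(1)]) blast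
  obtain N where N: "\<And>\<phi>. \<phi> \<in> mollifiers N \<Longrightarrow>
      \<forall>\<^sub>F \<epsilon> in at_right 0. \<forall>x\<in>S. \<bar>b (rescale \<epsilon> \<phi>) x\<bar> \<le> 1 / \<epsilon> ^ N"
    by (rule moderate_onE[OF assms(2)]) blast
  show ?thesis
  proof (rule moderate_onI[where N = "M + N"], rule exI[where x = 2])
    fix \<phi> :: "real ^ 'a \<Rightarrow> real" assume "\<phi> \<in> mollifiers (M + N)"
    then have "\<phi> \<in> mollifiers M" "\<phi> \<in> mollifiers N"
      by (auto elim: mollifiers_antimono)
    from M[OF this(1)] N[OF this(2)] eventually_small[of 0]
    show "\<forall>\<^sub>F \<epsilon> in at_right 0. \<forall>x\<in>S.
        \<bar>a (rescale \<epsilon> \<phi>) x + b (rescale \<epsilon> \<phi>) x\<bar> \<le> 2 / \<epsilon> ^ (M + N)"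
    proof eventually_elim
      case (elim \<epsilon>)
      then have le: "1 / \<epsilon> ^ M \<le> 1 / \<epsilon> ^ (M + N)" "1 / \<epsilon> ^ N \<le> 1 / \<epsilon> ^ (M + N)"
        by (intro inverse_power_mono; simp)+
      show ?case
      proof
        fix x assume "x \<in> S"
        with elim have "\<bar>a (rescale \<epsilon> \<phi>) x\<bar> \<le> 1 / \<epsilon> ^ M" "\<bar>b (rescale \<epsilon> \<phi>) x\<bar> \<le> 1 / \<epsilon> ^ N"
          by blast+
        with le show "\<bar>a (rescale \<epsilon> \<phi>) x + b (rescale \<epsilon> \<phi>) x\<bar> \<le> 2 / \<epsilon> ^ (M + N)"
          by linarith
      qed
    qed
  qed
qed

lemma moderate_on_mult:
  assumes "moderate_on S a" "moderate_on S b"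
  shows "moderate_on S (\<lambda>\<psi> x. a \<psi> x * b \<psi> x)"
proof -
  obtain M where M: "\<And>\<phi>. \<phi> \<in> mollifiers M \<Longrightarrow>
      \<forall>\<^sub>F \<epsilon> in at_right 0. \<forall>x\<in>S. \<bar>a (rescale \<epsilon> \<phi>) x\<bar> \<le> 1 / \<epsilon> ^ M"
    by (rule moderate_onE[OF assms(1)]) blast
  obtain N where N: "\<And>\<phi>. \<phi> \<in> mollifiers N \<Longrightarrow>
      \<forall>\<^sub>F \<epsilon> in at_right 0. \<forall>x\<in>S. \<bar>b (rescale \<epsilon> \<phi>) x\<bar> \<le> 1 / \<epsilon> ^ N"
    by (rule moderate_onE[OF assms(2)]) blast
  show ?thesis
  proof (rule moderate_onI[where N = "M + N"], rule exI[where x = 1])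
    fix \<phi> :: "real ^ 'a \<Rightarrow> real" assume "\<phi> \<in> mollifiers (M + N)"
    then have "\<phi> \<in> mollifiers M" "\<phi> \<in> mollifiers N"
      by (auto elim: mollifiers_antimono)
    from M[OF this(1)] N[OF this(2)] eventually_small[of 0]
    show "\<forall>\<^sub>F \<epsilon> in at_right 0. \<forall>x\<in>S.
        \<bar>a (rescale \<epsilon> \<phi>) x * b (rescale \<epsilon> \<phi>) x\<bar> \<le> 1 / \<epsilon> ^ (M + N)"
    proof eventually_elim
      case (elim \<epsilon>)
      show ?case
      proof
        fix x assume "x \<in> S"
        with elim have "\<bar>a (rescale \<epsilon> \<phi>) x\<bar> * \<bar>b (rescale \<epsilon> \<phi>) x\<bar> \<le> (1 / \<epsilon> ^ M) * (1 / \<epsilon> ^ N)"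
          by (intro mult_mono) auto
        then show "\<bar>a (rescale \<epsilon> \<phi>) x * b (rescale \<epsilon> \<phi>) x\<bar> \<le> 1 / \<epsilon> ^ (M + N)"
          by (simp add: abs_mult power_add)
      qed
    qed
  qed
qed

lemma negligible_on_add:
  assumes "negligible_on S a" "negligible_on S b"
  shows "negligible_on S (\<lambda>\<psi> x. a \<psi> x + b \<psi> x)"
proof -
  obtain M where M: "\<And>q \<phi>. M \<le> q \<Longrightarrow> \<phi> \<in> mollifiers q \<Longrightarrow>
      \<forall>\<^sub>F \<epsilon> in at_right 0. \<forall>x\<in>S. \<bar>a (rescale \<epsilon> \<phi>) x\<bar> \<le> \<epsilon> ^ (q - M)"
    by (rule negligible_onE[OF assms(1)]) blast
  obtain N where N: "\<And>q \<phi>. N \<le> q \<Longrightarrow> \<phi> \<in> mollifiers q \<Longrightarrow>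
      \<forall>\<^sub>F \<epsilon> in at_right 0. \<forall>x\<in>S. \<bar>b (rescale \<epsilon> \<phi>) x\<bar> \<le> \<epsilon> ^ (q - N)"
    by (rule negligible_onE[OF assms(2)]) blast
  show ?thesis
  proof (rule negligible_onI[where N = "M + N"], rule exI[where x = 2])
    fix q and \<phi> :: "real ^ 'a \<Rightarrow> real" assume q: "M + N \<le> q" and \<phi>: "\<phi> \<in> mollifiers q"
    have "M \<le> q" "N \<le> q" using q by auto
    from M[OF this(1) \<phi>] N[OF this(2) \<phi>] eventually_small[of 0]
    show "\<forall>\<^sub>F \<epsilon> in at_right 0. \<forall>x\<in>S.
        \<bar>a (rescale \<epsilon> \<phi>) x + b (rescale \<epsilon> \<phi>) x\<bar> \<le> 2 * \<epsilon> ^ (q - (M + N))"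
    proof eventually_elim
      case (elim \<epsilon>)
      then have le: "\<epsilon> ^ (q - M) \<le> \<epsilon> ^ (q - (M + N))" "\<epsilon> ^ (q - N) \<le> \<epsilon> ^ (q - (M + N))"
        by (intro power_decreasing; simp)+
      show ?case
      proof
        fix x assume "x \<in> S"
        with elim have "\<bar>a (rescale \<epsilon> \<phi>) x\<bar> \<le> \<epsilon> ^ (q - M)" "\<bar>b (rescale \<epsilon> \<phi>) x\<bar> \<le> \<epsilon> ^ (q - N)"
          by blast+
        with le show "\<bar>a (rescale \<epsilon> \<phi>) x + b (rescale \<epsilon> \<phi>) x\<bar> \<le> 2 * \<epsilon> ^ (q - (M + N))"
          by linarith
      qed
    qed
  qed
qed

lemma negligible_on_mult:
  assumes "moderate_on S a" "negligible_on S b"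
  shows "negligible_on S (\<lambda>\<psi> x. a \<psi> x * b \<psi> x)"
proof -
  obtain M where M: "\<And>\<phi>. \<phi> \<in> mollifiers M \<Longrightarrow>
      \<forall>\<^sub>F \<epsilon> in at_right 0. \<forall>x\<in>S. \<bar>a (rescale \<epsilon> \<phi>) x\<bar> \<le> 1 / \<epsilon> ^ M"
    by (rule moderate_onE[OF assms(1)]) blast
  obtain N where N: "\<And>q \<phi>. N \<le> q \<Longrightarrow> \<phi> \<in> mollifiers q \<Longrightarrow>
      \<forall>\<^sub>F \<epsilon> in at_right 0. \<forall>x\<in>S. \<bar>b (rescale \<epsilon> \<phi>) x\<bar> \<le> \<epsilon> ^ (q - N)"
    by (rule negligible_onE[OF assms(2)]) blast
  show ?thesis
  proof (rule negligible_onI[where N = "M + N"], rule exI[where x = 1])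
    fix q and \<phi> :: "real ^ 'a \<Rightarrow> real" assume q: "M + N \<le> q" and \<phi>: "\<phi> \<in> mollifiers q"
    then have "\<phi> \<in> mollifiers M" "N \<le> q" by (auto elim: mollifiers_antimono)
    from M[OF this(1)] N[OF this(2) \<phi>] eventually_small[of 0]
    show "\<forall>\<^sub>F \<epsilon> in at_right 0. \<forall>x\<in>S.
        \<bar>a (rescale \<epsilon> \<phi>) x * b (rescale \<epsilon> \<phi>) x\<bar> \<le> 1 * \<epsilon> ^ (q - (M + N))"
    proof eventually_elim
      case (elim \<epsilon>)
      have "q - N = (q - (M + N)) + M" using q by simp
      then have eq: "(1 / \<epsilon> ^ M) * \<epsilon> ^ (q - N) = \<epsilon> ^ (q - (M + N))"
        using elim by (simp add: power_add)
      show ?case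
      proof
        fix x assume "x \<in> S"
        with elim have "\<bar>a (rescale \<epsilon> \<phi>) x\<bar> * \<bar>b (rescale \<epsilon> \<phi>) x\<bar> \<le> (1 / \<epsilon> ^ M) * \<epsilon> ^ (q - N)"
          by (intro mult_mono) auto
        then show "\<bar>a (rescale \<epsilon> \<phi>) x * b (rescale \<epsilon> \<phi>) x\<bar> \<le> 1 * \<epsilon> ^ (q - (M + N))"
          unfolding eq by (simp add: abs_mult)
      qed
    qed
  qed
qed

lemma moderate_on_sum_list:
  "(\<And>p. p \<in> set ps \<Longrightarrow> moderate_on S (F p)) \<Longrightarrow> moderate_on S (\<lambda>\<psi> x. \<Sum>p\<leftarrow>ps. F p \<psi> x)"
  by (induction ps) (simp_all add: moderate_on_const moderate_on_add)

lemma negligible_on_sum_list: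
  "(\<And>p. p \<in> set ps \<Longrightarrow> negligible_on S (F p)) \<Longrightarrow> negligible_on S (\<lambda>\<psi> x. \<Sum>p\<leftarrow>ps. F p \<psi> x)"
  by (induction ps) (simp_all add: negligible_on_0 negligible_on_add)

section \<open>Smoothness up to the boundary along an exhaustion\<close>

text \<open>The two cases \<open>X = \<Omega>\<close> and \<open>X = closure \<Omega>\<close> are treated together: what they share is an
  exhaustion of \<open>X\<close> by compact sets \<open>C m\<close>, each in the interior of the next relative to \<open>X\<close>.
  Within \<open>X\<close>, the open set \<open>W m\<close> lies between \<open>C m\<close> and \<open>C (Suc m)\<close>; identities between functions
  are differentiated on \<open>W m \<inter> \<Omega>\<close>, since derivatives are local on open sets.\<close>

locale exhausted_region =
  fixes \<Omega> X :: "(real ^ 'n) set" and C W :: "nat \<Rightarrow> (real ^ 'n) set"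
  assumes open_Omega: "open \<Omega>" and Omega_subset: "\<Omega> \<subseteq> X" and subset_closure: "X \<subseteq> closure \<Omega>"
    and compact_C: "compact (C m)" and C_subset: "C m \<subseteq> X"
    and open_W: "open (W m)" and C_subset_W: "C m \<subseteq> W m" and W_subset_C: "W m \<inter> X \<subseteq> C (Suc m)"
    and absorbs: "compact K \<Longrightarrow> K \<subseteq> X \<Longrightarrow> \<exists>m. K \<subseteq> C m"
begin

lemma C_mono: "m \<le> n \<Longrightarrow> C m \<subseteq> C n"
proof (rule lift_Suc_mono_le)
  show "C k \<subseteq> C (Suc k)" for k
    using C_subset[of k] C_subset_W[of k] W_subset_C[of k] by blast
qed

definition extendable :: "(real ^ 'n \<Rightarrow> real) \<Rightarrow> bool" where
  "extendable a \<longleftrightarrow> (\<exists>g. continuous_on X g \<and> (\<forall>x\<in>\<Omega>. g x = a x))"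

lemma smooth_upto_iff:
  "smooth_upto \<Omega> X f \<longleftrightarrow>
     smooth_on \<Omega> f \<and> continuous_on X f \<and> (\<forall>is. ordered is \<longrightarrow> extendable (iter_pd is f))"
  unfolding smooth_upto_def smooth_on_def extendable_def
    all_multi_deriv_iff[of "\<lambda>D. \<exists>g. continuous_on X g \<and> (\<forall>x\<in>\<Omega>. g x = D f x)"] by blast

lemma extendable_cong: "(\<And>x. x \<in> \<Omega> \<Longrightarrow> a x = b x) \<Longrightarrow> extendable a \<Longrightarrow> extendable b"
  unfolding extendable_def by force

lemma continuous_imp_extendable: "continuous_on X a \<Longrightarrow> extendable a"
  unfolding extendable_def by blast

lemma extendable_add: "extendable a \<Longrightarrow> extendable b \<Longrightarrow> extendable (\<lambda>x. a x + b x)"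
  unfolding extendable_def
proof (elim exE conjE)
  fix f g assume "continuous_on X f" "\<forall>x\<in>\<Omega>. f x = a x" "continuous_on X g" "\<forall>x\<in>\<Omega>. g x = b x"
  then show "\<exists>g. continuous_on X g \<and> (\<forall>x\<in>\<Omega>. g x = a x + b x)"
    by (intro exI[of _ "\<lambda>x. f x + g x"]) (auto intro: continuous_on_add)
qed

lemma extendable_mult: "extendable a \<Longrightarrow> extendable b \<Longrightarrow> extendable (\<lambda>x. a x * b x)"
  unfolding extendable_def
proof (elim exE conjE)
  fix f g assume "continuous_on X f" "\<forall>x\<in>\<Omega>. f x = a x" "continuous_on X g" "\<forall>x\<in>\<Omega>. g x = b x"
  then show "\<exists>g. continuous_on X g \<and> (\<forall>x\<in>\<Omega>. g x = a x * b x)"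
    by (intro exI[of _ "\<lambda>x. f x * g x"]) (auto intro: continuous_on_mult)
qed

lemma extendable_diff: "extendable a \<Longrightarrow> extendable b \<Longrightarrow> extendable (\<lambda>x. a x - b x)"
  using extendable_add[of a "\<lambda>x. -1 * b x"]
    extendable_mult[OF continuous_imp_extendable[OF continuous_on_const[of X "-1"]], of b]
  by simp

lemma extendable_sum_list:
  "(\<And>p. p \<in> set ps \<Longrightarrow> extendable (F p)) \<Longrightarrow> extendable (\<lambda>x. \<Sum>p\<leftarrow>ps. F p x)"
  by (induction ps) (simp_all add: continuous_imp_extendable extendable_add)

lemma smooth_upto_cong:
  assumes "\<And>x. x \<in> X \<Longrightarrow> f x = g x" "smooth_upto \<Omega> X f"
  shows "smooth_upto \<Omega> X g"
proof -
  have eq: "f x = g x" if "x \<in> \<Omega>" for x using assms(1) that Omega_subset by blast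
  have "extendable (iter_pd is g)" if "ordered is" for "is"
    by (rule extendable_cong[OF iter_pd_cong_open[OF open_Omega _ eq]])
       (use assms(2) that in \<open>auto simp: smooth_upto_iff\<close>)
  moreover have "smooth_on \<Omega> g"
    by (rule smooth_on_cong[OF open_Omega eq]) (use assms(2) in \<open>auto simp: smooth_upto_iff\<close>)
  moreover have "continuous_on X g"
    using assms by (auto simp: smooth_upto_iff cong: continuous_on_cong)
  ultimately show ?thesis by (simp add: smooth_upto_iff)
qed

lemma smooth_upto_if_smooth_on_UNIV:
  assumes "smooth_on UNIV f"
  shows "smooth_upto \<Omega> X f"
proof -
  have "continuous_on X (iter_pd is f)" for "is"
    using smooth_on_continuous_on[OF smooth_on_iter_pd[OF assms]] continuous_on_subset by blast
  from this continuous_imp_extendable[OF this] this[of "[]"] smooth_on_subset[OF assms]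
  show ?thesis by (simp add: smooth_upto_iff)
qed

lemma smooth_upto_const: "smooth_upto \<Omega> X (\<lambda>x. c)"
  by (intro smooth_upto_if_smooth_on_UNIV smooth_on_const)

lemma smooth_upto_add:
  assumes "smooth_upto \<Omega> X f" "smooth_upto \<Omega> X g"
  shows "smooth_upto \<Omega> X (\<lambda>x. f x + g x)"
proof -
  have "extendable (iter_pd is (\<lambda>x. f x + g x))" if "ordered is" for "is"
  proof (rule extendable_cong)
    show "extendable (\<lambda>x. iter_pd is f x + iter_pd is g x)"
      using assms that by (intro extendable_add) (auto simp: smooth_upto_iff)
    show "iter_pd is f x + iter_pd is g x = iter_pd is (\<lambda>x. f x + g x) x" if "x \<in> \<Omega>" for x
      using assms that by (intro iter_pd_add[symmetric, OF open_Omega]) (auto simp: smooth_upto_iff)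
  qed
  then show ?thesis
    using assms open_Omega by (simp add: smooth_upto_iff smooth_on_add continuous_on_add)
qed

lemma smooth_upto_mult:
  assumes "smooth_upto \<Omega> X f" "smooth_upto \<Omega> X g"
  shows "smooth_upto \<Omega> X (\<lambda>x. f x * g x)"
proof -
  have s: "smooth_on \<Omega> f" "smooth_on \<Omega> g"
    and ext: "\<And>is. ordered is \<Longrightarrow> extendable (iter_pd is f)" "\<And>is. ordered is \<Longrightarrow> extendable (iter_pd is g)"
    using assms by (auto simp: smooth_upto_iff)
  have "extendable (iter_pd is (\<lambda>x. f x * g x))" if ord: "ordered is" for "is"
  proof -
    obtain ps where
      ps: "\<And>js ks. (js, ks) \<in> set ps \<Longrightarrow> subseq js is \<and> subseq ks is \<and> length ks < length is"
      and eq: "\<And>S f g x. \<lbrakk>open S; smooth_on S f; smooth_on S g; x \<in> S\<rbrakk> \<Longrightarrow>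
         iter_pd is (\<lambda>x. f x * g x) x
           = f x * iter_pd is g x + (\<Sum>(js, ks)\<leftarrow>ps. iter_pd js f x * iter_pd ks g x)"
      by (rule leibniz[of "is"]) blast
    have "ordered (fst p) \<and> ordered (snd p)" if "p \<in> set ps" for p
      using ps[of "fst p" "snd p"] that ordered_subseq[OF ord] by simp
    then have "extendable (\<lambda>x. iter_pd [] f x * iter_pd is g x
        + (\<Sum>p\<leftarrow>ps. iter_pd (fst p) f x * iter_pd (snd p) g x))"
      by (intro extendable_add extendable_mult extendable_sum_list ext ord ordered_Nil) simp_all
    then show ?thesis
      by (rule extendable_cong[rotated])
         (use eq[OF open_Omega s] in \<open>simp add: case_prod_unfold\<close>)
  qed
  then show ?thesis
    using assms open_Omega by (simp add: smooth_upto_iff smooth_on_mult continuous_on_mult)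
qed

text \<open>By \<open>leibniz_reciprocal\<close>, the extension of a derivative of \<open>1 / f\<close> is built from \<open>1 / f\<close>, which is
  continuous on \<open>X\<close>, and from the extensions of lower derivatives.\<close>

lemma smooth_upto_inverse:
  assumes "smooth_upto \<Omega> X f" "\<And>x. x \<in> X \<Longrightarrow> f x \<noteq> 0"
  shows "smooth_upto \<Omega> X (\<lambda>x. inverse (f x))"
proof -
  let ?g = "\<lambda>x. inverse (f x)"
  have s: "smooth_on \<Omega> f" "smooth_on \<Omega> ?g"
    and ext: "\<And>is. ordered is \<Longrightarrow> extendable (iter_pd is f)"
    using assms Omega_subset by (auto simp: smooth_upto_iff intro!: smooth_on_inverse[OF open_Omega])
  have cont: "continuous_on X ?g"
    using assms by (auto simp: smooth_upto_iff intro: continuous_on_inverse)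
  have one: "f x * ?g x = 1" if "x \<in> \<Omega>" for x
    using assms(2) that Omega_subset by auto
  have "extendable (iter_pd is ?g)" if "ordered is" for "is"
    using that
  proof (induction "is" rule: length_induct)
    case (1 "is")
    obtain ps where
      ps: "\<And>js ks. (js, ks) \<in> set ps \<Longrightarrow> subseq js is \<and> subseq ks is \<and> length ks < length is"
      and eq: "\<And>S f g x. \<lbrakk>open S; smooth_on S f; smooth_on S g; \<And>y. y \<in> S \<Longrightarrow> f y * g y = 1; x \<in> S\<rbrakk> \<Longrightarrow>
       iter_pd is g x
         = g x * ((if is = [] then 1 else 0) - (\<Sum>(js, ks)\<leftarrow>ps. iter_pd js f x * iter_pd ks g x))"
      by (rule leibniz_reciprocal[of "is"]) blast
    have "extendable (iter_pd (snd p) ?g)" if "p \<in> set ps" for p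
      using "1.IH" ps[of "fst p" "snd p"] ordered_subseq[OF "1.prems"] that by auto
    moreover have "extendable (iter_pd (fst p) f)" if "p \<in> set ps" for p
      using ps[of "fst p" "snd p"] ordered_subseq[OF "1.prems"] that by (auto intro: ext)
    ultimately have "extendable (\<lambda>x. ?g x * ((if is = [] then 1 else 0)
        - (\<Sum>p\<leftarrow>ps. iter_pd (fst p) f x * iter_pd (snd p) ?g x)))"
      by (intro extendable_mult extendable_diff extendable_sum_list
          continuous_imp_extendable[OF cont] continuous_imp_extendable[OF continuous_on_const])
    then show ?case
      by (rule extendable_cong[rotated])
         (use eq[OF open_Omega s one] in \<open>simp add: case_prod_unfold\<close>)
  qed
  with s cont show ?thesis by (simp add: smooth_upto_iff)
qed

text \<open>Every point of \<open>C m\<close> is a limit of points of \<open>\<Omega>\<close> inside \<open>W m\<close>, hence inside \<open>C (Suc m)\<close>. Passing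
  from \<open>\<Omega>\<close> to the boundary therefore costs one step of the exhaustion.\<close>

lemma closed_condition_on_C:
  assumes "continuous_on X f" "closed T" "\<And>x. x \<in> C (Suc m) \<inter> \<Omega> \<Longrightarrow> f x \<in> T" "x \<in> C m"
  shows "f x \<in> T"
proof -
  obtain Z where Z: "closed Z" "X \<inter> f -` T = X \<inter> Z"
    using continuous_closedin_preimage[OF assms(1,2)] by (auto simp: closedin_closed)
  have "W m \<inter> \<Omega> \<subseteq> Z"
    using Z(2) assms(3) W_subset_C[of m] Omega_subset by blast
  then have "closure (W m \<inter> \<Omega>) \<subseteq> Z" using Z(1) by (rule closure_minimal)
  moreover have "x \<in> closure (W m \<inter> \<Omega>)"
    using open_Int_closure_subset[OF open_W] assms(4) C_subset C_subset_W subset_closure by blast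
  ultimately show ?thesis using Z(2) assms(4) C_subset by blast
qed

lemma deriv_upto_bound:
  assumes f: "smooth_upto \<Omega> X f"
    and bound: "\<And>x. x \<in> C (Suc m) \<inter> \<Omega> \<Longrightarrow> \<bar>multi_deriv \<alpha> f x\<bar> \<le> B" and x: "x \<in> C m"
  shows "\<bar>deriv_upto \<Omega> \<alpha> f x\<bar> \<le> B"
proof -
  obtain g where g: "continuous_on X g" "\<And>x. x \<in> \<Omega> \<Longrightarrow> g x = multi_deriv \<alpha> f x"
    using f unfolding smooth_upto_def by blast
  have xX: "x \<in> X" using x C_subset by blast
  have "deriv_upto \<Omega> \<alpha> f x = g x"
  proof (cases "x \<in> \<Omega>")
    case False
    then have "x islimpt \<Omega>"
      using xX subset_closure by (auto simp: closure_def)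
    then have nt: "at x within \<Omega> \<noteq> bot"
      by (simp add: trivial_limit_within)
    have "(g \<longlongrightarrow> g x) (at x within \<Omega>)"
      using g(1) xX by (auto simp: continuous_on_def intro: tendsto_within_subset[OF _ Omega_subset])
    then have "(multi_deriv \<alpha> f \<longlongrightarrow> g x) (at x within \<Omega>)"
      by (rule Lim_transform_eventually) (auto simp: eventually_at_filter g(2))
    with False show ?thesis
      using tendsto_Lim[OF nt] by (simp add: deriv_upto_def)
  qed (simp add: deriv_upto_def g(2))
  moreover have "g x \<in> {-B..B}"
  proof (rule closed_condition_on_C[OF g(1) closed_atLeastAtMost _ x])
    fix y assume "y \<in> C (Suc m) \<inter> \<Omega>"
    then show "g y \<in> {-B..B}" using bound[of y] g(2)[of y] by (auto simp: abs_le_iff)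
  qed
  ultimately show ?thesis by auto
qed

text \<open>If \<open>f\<close> has no zero on \<open>X\<close>, take \<open>d = 0\<close>. Otherwise let \<open>C (Suc m)\<close> be the first set after \<open>C 0\<close> on
  which \<open>f\<close> has a zero. If \<open>m = 0\<close>, then \<open>d\<close> has to vanish nowhere and \<open>d = 1\<close> will do; if \<open>m = Suc j\<close>,
  then all zeros of \<open>f\<close> lie outside \<open>C (Suc j)\<close>, so a cutoff that vanishes on \<open>C j\<close> and is positive
  outside \<open>C (Suc j)\<close> does.\<close>

lemma regularizer:
  obtains d where "smooth_on UNIV d" "\<And>x. x \<in> X \<Longrightarrow> 0 < f x * f x + d x"
    "\<And>m x. (\<And>y. y \<in> C (Suc m) \<Longrightarrow> f y \<noteq> (0 :: real)) \<Longrightarrow> x \<in> C m \<Longrightarrow> d x = 0"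
proof (cases "\<forall>m. \<forall>x\<in>C (Suc m). f x \<noteq> 0")
  case True
  have "f x \<noteq> 0" if "x \<in> X" for x
  proof -
    obtain m where "{x} \<subseteq> C m" using absorbs[of "{x}"] \<open>x \<in> X\<close> by auto
    then show ?thesis using True C_mono[of m "Suc m"] by auto
  qed
  then show thesis
    by (intro that[of "\<lambda>_. 0"]) (auto simp: smooth_on_const zero_less_mult_iff linorder_neq_iff)
next
  case False
  define m where "m = (LEAST m. \<exists>x\<in>C (Suc m). f x = 0)"
  have zero: "\<exists>x\<in>C (Suc m). f x = 0"
    unfolding m_def by (rule LeastI_ex) (use False in blast)
  have less: "k < m" if "\<And>y. y \<in> C (Suc k) \<Longrightarrow> f y \<noteq> 0" for k
  proof (rule ccontr)
    assume "\<not> k < m"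
    then show False using zero C_mono[of "Suc m" "Suc k"] that by auto
  qed
  show thesis
  proof (cases m)
    case 0
    then show thesis
      using less by (intro that[of "\<lambda>_. 1"]) (auto simp: smooth_on_const add_nonneg_pos)
  next
    case (Suc j)
    have ne: "f x \<noteq> 0" if "x \<in> C (Suc j)" for x
      using not_less_Least[of j "\<lambda>m. \<exists>x\<in>C (Suc m). f x = 0"] that Suc by (auto simp: m_def)
    obtain d where d: "smooth_on UNIV d" "\<And>x. 0 \<le> d x" "\<And>x. x \<in> C j \<Longrightarrow> d x = 0"
      "\<And>x. x \<notin> W j \<Longrightarrow> 0 < d x"
      by (rule smooth_vanishing_on_compact[OF compact_C open_W C_subset_W]) blast
    show thesis
    proof (rule that[OF d(1)])
      show "0 < f x * f x + d x" if "x \<in> X" for x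
      proof (cases "f x = 0")
        case True
        then have "x \<notin> W j" using ne W_subset_C[of j] that by blast
        then show ?thesis using d(4) True by simp
      next
        case False
        then have "0 < f x * f x" by (auto simp: zero_less_mult_iff linorder_neq_iff)
        then show ?thesis using d(2)[of x] by linarith
      qed
      show "d x = 0" if "\<And>y. y \<in> C (Suc k) \<Longrightarrow> f y \<noteq> 0" "x \<in> C k" for k x
      proof -
        have "k < m" by (rule less) (rule that(1))
        then have "C k \<subseteq> C j" using Suc by (intro C_mono) simp
        then show ?thesis using that(2) d(3) by blast
      qed
    qed
  qed
qed

end

section \<open>The ring of moderate nets and its ideal of negligible nets\<close>

lemma
  shows carrier_moderate_ring [simp]: "carrier (moderate_ring \<Omega> X) = moderate \<Omega> X"
    and mult_moderate_ring: "u \<otimes>\<^bsub>moderate_ring \<Omega> X\<^esub> v = restrict (\<lambda>z. u z * v z) (mollifiers 0 \<times> X)"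
    and add_moderate_ring: "u \<oplus>\<^bsub>moderate_ring \<Omega> X\<^esub> v = restrict (\<lambda>z. u z + v z) (mollifiers 0 \<times> X)"
    and one_moderate_ring: "\<one>\<^bsub>moderate_ring \<Omega> X\<^esub> = restrict (\<lambda>_. 1) (mollifiers 0 \<times> X)"
    and zero_moderate_ring: "\<zero>\<^bsub>moderate_ring \<Omega> X\<^esub> = restrict (\<lambda>_. 0) (mollifiers 0 \<times> X)"
  by (simp_all add: moderate_ring_def)

lemmas moderate_ring_ops = mult_moderate_ring add_moderate_ring one_moderate_ring zero_moderate_ring

text \<open>The lower bound that characterises invertibility, tested on the members of an exhaustion only;
  \<open>bounded_away_iff\<close> compares it with the condition on all compact sets.\<close>

definition bounded_away :: "(nat \<Rightarrow> (real ^ 'n) set) \<Rightarrow> 'n net \<Rightarrow> bool" where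
  "bounded_away C u \<longleftrightarrow> (\<forall>m. \<exists>p. \<forall>\<phi>\<in>mollifiers p. \<forall>\<^sub>F \<epsilon> in at_right 0.
     \<forall>x\<in>C m. \<epsilon> ^ p \<le> \<bar>u (rescale \<epsilon> \<phi>, x)\<bar>)"

context exhausted_region
begin

abbreviation R where "R \<equiv> moderate_ring \<Omega> X"
abbreviation \<N> where "\<N> \<equiv> negligible_nets \<Omega> X"

abbreviation pd_net :: "'n list \<Rightarrow> 'n net \<Rightarrow> (real ^ 'n \<Rightarrow> real) \<Rightarrow> real ^ 'n \<Rightarrow> real" where
  "pd_net is u \<equiv> \<lambda>\<psi>. iter_pd is (\<lambda>x. u (\<psi>, x))"

lemma nets_smooth_upto:
  "u \<in> nets \<Omega> X \<Longrightarrow> \<psi> \<in> mollifiers 0 \<Longrightarrow> smooth_upto \<Omega> X (\<lambda>x. u (\<psi>, x))"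
  by (auto simp: nets_def)

lemma nets_smooth_on:
  "u \<in> nets \<Omega> X \<Longrightarrow> \<psi> \<in> mollifiers 0 \<Longrightarrow> smooth_on \<Omega> (\<lambda>x. u (\<psi>, x))"
  using nets_smooth_upto by (auto simp: smooth_upto_iff)

lemma nets_continuous_on:
  "u \<in> nets \<Omega> X \<Longrightarrow> \<psi> \<in> mollifiers 0 \<Longrightarrow> continuous_on X (\<lambda>x. u (\<psi>, x))"
  using nets_smooth_upto by (auto simp: smooth_upto_iff)

text \<open>The ring operations are pointwise operations followed by a restriction, which changes no value on
  \<open>mollifiers 0 \<times> X\<close>.\<close>

lemma restrict_in_nets:
  assumes "\<And>\<psi>. \<psi> \<in> mollifiers 0 \<Longrightarrow> smooth_upto \<Omega> X (\<lambda>x. f (\<psi>, x))"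
  shows "restrict f (mollifiers 0 \<times> X) \<in> nets \<Omega> X"
  unfolding nets_def
proof (intro CollectI conjI ballI)
  fix \<psi> :: "real ^ 'n \<Rightarrow> real" assume "\<psi> \<in> mollifiers 0"
  then show "smooth_upto \<Omega> X (\<lambda>x. restrict f (mollifiers 0 \<times> X) (\<psi>, x))"
    by (intro smooth_upto_cong[OF _ assms[of \<psi>]]) auto
qed simp

lemma pd_net_restrict:
  assumes "\<psi> \<in> mollifiers 0" "x \<in> \<Omega>"
  shows "pd_net is (restrict f (mollifiers 0 \<times> X)) \<psi> x = pd_net is f \<psi> x"
  by (rule iter_pd_cong_open[OF open_Omega assms(2)]) (use assms(1) Omega_subset in auto)

text \<open>It suffices to estimate the derivatives in \<open>\<Omega>\<close> on the sets of the exhaustion: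
  \<open>deriv_upto_bound\<close> carries the bounds over to the boundary.\<close>

lemma moderate_iff:
  "u \<in> moderate \<Omega> X \<longleftrightarrow>
     u \<in> nets \<Omega> X \<and> (\<forall>m is. ordered is \<longrightarrow> moderate_on (C m \<inter> \<Omega>) (pd_net is u))"
proof -
  define P where "P m D \<longleftrightarrow> moderate_on (C m \<inter> \<Omega>) (\<lambda>\<psi>. D (\<lambda>x. u (\<psi>, x)))" for m D
  have "u \<in> moderate \<Omega> X \<longleftrightarrow> u \<in> nets \<Omega> X \<and> (\<forall>m. \<forall>\<alpha>. P m (multi_deriv \<alpha>))"
  proof (intro iffI conjI allI)
    assume u: "u \<in> moderate \<Omega> X"
    show "u \<in> nets \<Omega> X" using u by (simp add: moderate_def)
    fix m \<alpha>
    from u[unfolded moderate_def ex_eta_iff, THEN CollectD, THEN conjunct2, THEN spec, of "C m",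
        THEN spec, of \<alpha>, THEN mp, OF conjI[OF compact_C C_subset]]
    obtain N where N: "\<And>\<phi>. \<phi> \<in> mollifiers N \<Longrightarrow> \<exists>C'>0. \<forall>\<^sub>F \<epsilon> in at_right 0.
        (SUP x\<in>C m. ereal \<bar>deriv_upto \<Omega> \<alpha> (\<lambda>y. u (rescale \<epsilon> \<phi>, y)) x\<bar>) \<le> ereal (C' / \<epsilon> ^ N)"
      by blast
    show "P m (multi_deriv \<alpha>)"
      unfolding P_def
    proof (rule moderate_onI)
      fix \<phi> :: "real ^ 'n \<Rightarrow> real" assume "\<phi> \<in> mollifiers N"
      from N[OF this] obtain c where "\<forall>\<^sub>F \<epsilon> in at_right 0.
          \<forall>x\<in>C m. \<bar>deriv_upto \<Omega> \<alpha> (\<lambda>y. u (rescale \<epsilon> \<phi>, y)) x\<bar> \<le> c / \<epsilon> ^ N"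
        by (auto simp: SUP_le_iff)
      then have "\<forall>\<^sub>F \<epsilon> in at_right 0.
          \<forall>x\<in>C m \<inter> \<Omega>. \<bar>multi_deriv \<alpha> (\<lambda>x. u (rescale \<epsilon> \<phi>, x)) x\<bar> \<le> c / \<epsilon> ^ N"
        by (rule eventually_mono) (auto simp: deriv_upto_def split: if_splits)
      then show "\<exists>c. \<forall>\<^sub>F \<epsilon> in at_right 0.
          \<forall>x\<in>C m \<inter> \<Omega>. \<bar>multi_deriv \<alpha> (\<lambda>x. u (rescale \<epsilon> \<phi>, x)) x\<bar> \<le> c / \<epsilon> ^ N"
        by blast
    qed
  next
    assume u: "u \<in> nets \<Omega> X \<and> (\<forall>m \<alpha>. P m (multi_deriv \<alpha>))"
    have key: "\<exists>N\<ge>1. \<forall>\<phi>\<in>mollifiers N. \<exists>c>0. \<forall>\<^sub>F \<epsilon> in at_right 0.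
        (SUP x\<in>K. ereal \<bar>deriv_upto \<Omega> \<alpha> (\<lambda>y. u (rescale \<epsilon> \<phi>, y)) x\<bar>) \<le> ereal (c / \<epsilon> ^ N)"
      if K: "compact K \<and> K \<subseteq> X" for K \<alpha>
    proof -
      obtain m where m: "K \<subseteq> C m" using absorbs K by blast
      have "P (Suc m) (multi_deriv \<alpha>)" using u by blast
      then obtain N where N: "\<And>\<phi>. \<phi> \<in> mollifiers N \<Longrightarrow> \<forall>\<^sub>F \<epsilon> in at_right 0.
          \<forall>x\<in>C (Suc m) \<inter> \<Omega>. \<bar>multi_deriv \<alpha> (\<lambda>x. u (rescale \<epsilon> \<phi>, x)) x\<bar> \<le> 1 / \<epsilon> ^ N"
        unfolding P_def by (rule moderate_onE) blast
      have "\<forall>\<^sub>F \<epsilon> in at_right 0.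
          (SUP x\<in>K. ereal \<bar>deriv_upto \<Omega> \<alpha> (\<lambda>y. u (rescale \<epsilon> \<phi>, y)) x\<bar>) \<le> ereal (1 / \<epsilon> ^ Suc N)"
        if \<phi>: "\<phi> \<in> mollifiers (Suc N)" for \<phi> :: "real ^ 'n \<Rightarrow> real"
        using N[OF mollifiers_antimono[OF \<phi> le_SucI[OF le_refl]]] eventually_rescale_mollifiers[OF \<phi>] eventually_small[of 0]
      proof eventually_elim
        case (elim \<epsilon>)
        have "1 / \<epsilon> ^ N \<le> 1 / \<epsilon> ^ Suc N"
          using elim(3) by (intro inverse_power_mono) auto
        moreover have "\<bar>deriv_upto \<Omega> \<alpha> (\<lambda>y. u (rescale \<epsilon> \<phi>, y)) x\<bar> \<le> 1 / \<epsilon> ^ N" if "x \<in> K" for x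
          by (rule deriv_upto_bound[of _ m])
             (use elim(1,2) u nets_smooth_upto m that in auto)
        ultimately show ?case
          unfolding SUP_le_iff ereal_less_eq by (meson order_trans)
      qed
      then show ?thesis
        by (intro exI[of _ "Suc N"] conjI ballI exI[of _ 1]) auto
    qed
    then show "u \<in> moderate \<Omega> X"
      unfolding moderate_def ex_eta_iff
      by (intro CollectI conjI allI impI key conjunct1[OF u]) simp_all
  qed
  moreover have "(\<forall>\<alpha>. P m (multi_deriv \<alpha>)) \<longleftrightarrow> (\<forall>is. ordered is \<longrightarrow> P m (iter_pd is))" for m
    by (rule all_multi_deriv_iff)
  ultimately show ?thesis unfolding P_def by simp
qed

lemma negligible_iff:
  "u \<in> \<N> \<longleftrightarrow>
     u \<in> moderate \<Omega> X \<and> (\<forall>m is. ordered is \<longrightarrow> negligible_on (C m \<inter> \<Omega>) (pd_net is u))"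
proof -
  define P where "P m D \<longleftrightarrow> negligible_on (C m \<inter> \<Omega>) (\<lambda>\<psi>. D (\<lambda>x. u (\<psi>, x)))" for m D
  have "u \<in> \<N> \<longleftrightarrow> u \<in> moderate \<Omega> X \<and> (\<forall>m. \<forall>\<alpha>. P m (multi_deriv \<alpha>))"
  proof (intro iffI conjI allI)
    assume u: "u \<in> \<N>"
    show "u \<in> moderate \<Omega> X" using u by (simp add: negligible_nets_def)
    fix m \<alpha>
    from u[unfolded negligible_nets_def ex_eta_iff, THEN CollectD, THEN conjunct2, THEN spec, of "C m",
        THEN spec, of \<alpha>, THEN mp, OF conjI[OF compact_C C_subset]]
    obtain N where N: "\<And>q \<phi>. N \<le> q \<Longrightarrow> \<phi> \<in> mollifiers q \<Longrightarrow> \<exists>C'>0. \<forall>\<^sub>F \<epsilon> in at_right 0.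
        (SUP x\<in>C m. ereal \<bar>deriv_upto \<Omega> \<alpha> (\<lambda>y. u (rescale \<epsilon> \<phi>, y)) x\<bar>) \<le> ereal (C' * \<epsilon> ^ (q - N))"
      by blast
    show "P m (multi_deriv \<alpha>)"
      unfolding P_def
    proof (rule negligible_onI)
      fix q and \<phi> :: "real ^ 'n \<Rightarrow> real" assume "N \<le> q" "\<phi> \<in> mollifiers q"
      from N[OF this] obtain c where "\<forall>\<^sub>F \<epsilon> in at_right 0.
          \<forall>x\<in>C m. \<bar>deriv_upto \<Omega> \<alpha> (\<lambda>y. u (rescale \<epsilon> \<phi>, y)) x\<bar> \<le> c * \<epsilon> ^ (q - N)"
        by (auto simp: SUP_le_iff)
      then have "\<forall>\<^sub>F \<epsilon> in at_right 0.
          \<forall>x\<in>C m \<inter> \<Omega>. \<bar>multi_deriv \<alpha> (\<lambda>x. u (rescale \<epsilon> \<phi>, x)) x\<bar> \<le> c * \<epsilon> ^ (q - N)"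
        by (rule eventually_mono) (auto simp: deriv_upto_def split: if_splits)
      then show "\<exists>c. \<forall>\<^sub>F \<epsilon> in at_right 0.
          \<forall>x\<in>C m \<inter> \<Omega>. \<bar>multi_deriv \<alpha> (\<lambda>x. u (rescale \<epsilon> \<phi>, x)) x\<bar> \<le> c * \<epsilon> ^ (q - N)"
        by blast
    qed
  next
    assume u: "u \<in> moderate \<Omega> X \<and> (\<forall>m \<alpha>. P m (multi_deriv \<alpha>))"
    then have nets: "u \<in> nets \<Omega> X" by (simp add: moderate_def)
    have key: "\<exists>N\<ge>1. \<forall>q\<ge>N. \<forall>\<phi>\<in>mollifiers q. \<exists>c>0. \<forall>\<^sub>F \<epsilon> in at_right 0.
        (SUP x\<in>K. ereal \<bar>deriv_upto \<Omega> \<alpha> (\<lambda>y. u (rescale \<epsilon> \<phi>, y)) x\<bar>) \<le> ereal (c * \<epsilon> ^ (q - N))"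
      if K: "compact K \<and> K \<subseteq> X" for K \<alpha>
    proof -
      obtain m where m: "K \<subseteq> C m" using absorbs K by blast
      have "P (Suc m) (multi_deriv \<alpha>)" using u by blast
      then obtain N where N: "\<And>q \<phi>. N \<le> q \<Longrightarrow> \<phi> \<in> mollifiers q \<Longrightarrow> \<forall>\<^sub>F \<epsilon> in at_right 0.
          \<forall>x\<in>C (Suc m) \<inter> \<Omega>. \<bar>multi_deriv \<alpha> (\<lambda>x. u (rescale \<epsilon> \<phi>, x)) x\<bar> \<le> \<epsilon> ^ (q - N)"
        unfolding P_def by (rule negligible_onE) blast
      have "\<forall>\<^sub>F \<epsilon> in at_right 0.
          (SUP x\<in>K. ereal \<bar>deriv_upto \<Omega> \<alpha> (\<lambda>y. u (rescale \<epsilon> \<phi>, y)) x\<bar>) \<le> ereal (1 * \<epsilon> ^ (q - Suc N))"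
        if q: "Suc N \<le> q" and \<phi>: "\<phi> \<in> mollifiers q" for q and \<phi> :: "real ^ 'n \<Rightarrow> real"
        using N[OF Suc_leD[OF q] \<phi>] eventually_rescale_mollifiers[OF \<phi>] eventually_small[of 0]
      proof eventually_elim
        case (elim \<epsilon>)
        have "\<epsilon> ^ (q - N) \<le> 1 * \<epsilon> ^ (q - Suc N)"
          unfolding mult_1 using elim(3) by (intro power_decreasing) auto
        moreover have "\<bar>deriv_upto \<Omega> \<alpha> (\<lambda>y. u (rescale \<epsilon> \<phi>, y)) x\<bar> \<le> \<epsilon> ^ (q - N)" if "x \<in> K" for x
          by (rule deriv_upto_bound[of _ m])
             (use elim(1,2) nets nets_smooth_upto m that in auto)
        ultimately show ?case
          unfolding SUP_le_iff ereal_less_eq by (meson order_trans)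
      qed
      then show ?thesis
        by (intro exI[of _ "Suc N"] conjI ballI allI impI exI[of _ 1]) auto
    qed
    then show "u \<in> \<N>"
      unfolding negligible_nets_def ex_eta_iff
      by (intro CollectI conjI allI impI key conjunct1[OF u]) simp_all
  qed
  moreover have "(\<forall>\<alpha>. P m (multi_deriv \<alpha>)) \<longleftrightarrow> (\<forall>is. ordered is \<longrightarrow> P m (iter_pd is))" for m
    by (rule all_multi_deriv_iff)
  ultimately show ?thesis unfolding P_def by simp
qed

lemma moderate_nets: "u \<in> moderate \<Omega> X \<Longrightarrow> u \<in> nets \<Omega> X"
  by (simp add: moderate_iff)

lemma negligible_moderate: "u \<in> \<N> \<Longrightarrow> u \<in> moderate \<Omega> X"
  by (simp add: negligible_iff)

lemma const_moderate: "restrict (\<lambda>_. c) (mollifiers 0 \<times> X) \<in> moderate \<Omega> X"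
proof -
  have "moderate_on (C m \<inter> \<Omega>) (pd_net is (restrict (\<lambda>_. c) (mollifiers 0 \<times> X)))" for m "is"
  proof (rule moderate_on_cong[OF _ moderate_on_const])
    show "pd_net is (restrict (\<lambda>_. c) (mollifiers 0 \<times> X)) \<psi> x = (if is = [] then c else 0)"
      if "\<psi> \<in> mollifiers 0" "x \<in> C m \<inter> \<Omega>" for \<psi> x
      using pd_net_restrict[OF that(1), of x "is" "\<lambda>_. c"] that(2) by (simp add: iter_pd_const)
  qed
  then show ?thesis
    by (simp add: moderate_iff restrict_in_nets smooth_upto_const)
qed

lemma pd_net_add:
  assumes "u \<in> nets \<Omega> X" "v \<in> nets \<Omega> X" "\<psi> \<in> mollifiers 0" "x \<in> \<Omega>"
  shows "pd_net is (u \<oplus>\<^bsub>R\<^esub> v) \<psi> x = pd_net is u \<psi> x + pd_net is v \<psi> x"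
  unfolding add_moderate_ring pd_net_restrict[OF assms(3,4)]
  by (rule iter_pd_add[OF open_Omega _ _ assms(4)]) (use assms nets_smooth_on in auto)

text \<open>Here all terms of the Leibniz rule are put on an equal footing, which is the form needed to see
  that products of moderate nets are moderate and that the negligible ones absorb products.\<close>

lemma pd_net_mult:
  assumes "ordered is"
  obtains ps where "\<And>p. p \<in> set ps \<Longrightarrow> ordered (fst p) \<and> ordered (snd p)"
    "\<And>u v \<psi> x. u \<in> nets \<Omega> X \<Longrightarrow> v \<in> nets \<Omega> X \<Longrightarrow> \<psi> \<in> mollifiers 0 \<Longrightarrow> x \<in> \<Omega> \<Longrightarrow>
      pd_net is (u \<otimes>\<^bsub>R\<^esub> v) \<psi> x = (\<Sum>p\<leftarrow>ps. pd_net (fst p) u \<psi> x * pd_net (snd p) v \<psi> x)"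
proof -
  obtain ps where
    ps: "\<And>js ks. (js, ks) \<in> set ps \<Longrightarrow> subseq js is \<and> subseq ks is \<and> length ks < length is"
    and eq: "\<And>S f g x. \<lbrakk>open S; smooth_on S f; smooth_on S g; x \<in> S\<rbrakk> \<Longrightarrow>
       iter_pd is (\<lambda>x. f x * g x) x
         = f x * iter_pd is g x + (\<Sum>(js, ks)\<leftarrow>ps. iter_pd js f x * iter_pd ks g x)"
    by (rule leibniz[of "is"]) blast
  show thesis
  proof (rule that[of "([], is) # ps"])
    show "ordered (fst p) \<and> ordered (snd p)" if "p \<in> set (([], is) # ps)" for p
      using that assms ps[of "fst p" "snd p"] ordered_subseq[OF assms] by auto
    show "pd_net is (u \<otimes>\<^bsub>R\<^esub> v) \<psi> x
        = (\<Sum>p\<leftarrow>([], is) # ps. pd_net (fst p) u \<psi> x * pd_net (snd p) v \<psi> x)"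
      if uv: "u \<in> nets \<Omega> X" "v \<in> nets \<Omega> X" and \<psi>: "\<psi> \<in> mollifiers 0" and x: "x \<in> \<Omega>" for u v \<psi> x
      unfolding mult_moderate_ring pd_net_restrict[OF \<psi> x]
      using eq[OF open_Omega uv[THEN nets_smooth_on, OF \<psi>] x] by (simp add: case_prod_unfold)
  qed
qed

lemma moderate_add:
  assumes "u \<in> moderate \<Omega> X" "v \<in> moderate \<Omega> X"
  shows "u \<oplus>\<^bsub>R\<^esub> v \<in> moderate \<Omega> X"
proof -
  have nets: "u \<in> nets \<Omega> X" "v \<in> nets \<Omega> X" using assms by (auto intro: moderate_nets)
  have "u \<oplus>\<^bsub>R\<^esub> v \<in> nets \<Omega> X"
    unfolding add_moderate_ring
    by (intro restrict_in_nets smooth_upto_add nets[THEN nets_smooth_upto])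
  moreover have "moderate_on (C m \<inter> \<Omega>) (pd_net is (u \<oplus>\<^bsub>R\<^esub> v))" if "ordered is" for m "is"
    by (rule moderate_on_cong[OF _ moderate_on_add[of _ "pd_net is u" "pd_net is v"]])
       (use pd_net_add[OF nets] assms that in \<open>auto simp: moderate_iff\<close>)
  ultimately show ?thesis by (simp add: moderate_iff)
qed

lemma moderate_mult:
  assumes "u \<in> moderate \<Omega> X" "v \<in> moderate \<Omega> X"
  shows "u \<otimes>\<^bsub>R\<^esub> v \<in> moderate \<Omega> X"
proof -
  have nets: "u \<in> nets \<Omega> X" "v \<in> nets \<Omega> X" using assms by (auto intro: moderate_nets)
  have "u \<otimes>\<^bsub>R\<^esub> v \<in> nets \<Omega> X"
    unfolding mult_moderate_ring
    by (intro restrict_in_nets smooth_upto_mult nets[THEN nets_smooth_upto])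
  moreover have "moderate_on (C m \<inter> \<Omega>) (pd_net is (u \<otimes>\<^bsub>R\<^esub> v))" if "ordered is" for m "is"
  proof -
    obtain ps where ps: "\<And>p. p \<in> set ps \<Longrightarrow> ordered (fst p) \<and> ordered (snd p)"
      and eq: "\<And>u v \<psi> x. u \<in> nets \<Omega> X \<Longrightarrow> v \<in> nets \<Omega> X \<Longrightarrow> \<psi> \<in> mollifiers 0 \<Longrightarrow> x \<in> \<Omega> \<Longrightarrow>
      pd_net is (u \<otimes>\<^bsub>R\<^esub> v) \<psi> x = (\<Sum>p\<leftarrow>ps. pd_net (fst p) u \<psi> x * pd_net (snd p) v \<psi> x)"
      by (rule pd_net_mult[OF \<open>ordered is\<close>]) blast
    show ?thesis
    proof (rule moderate_on_cong)
      show "moderate_on (C m \<inter> \<Omega>)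
          (\<lambda>\<psi> x. \<Sum>p\<leftarrow>ps. pd_net (fst p) u \<psi> x * pd_net (snd p) v \<psi> x)"
        using assms ps by (intro moderate_on_sum_list moderate_on_mult) (auto simp: moderate_iff)
    qed (use eq[OF nets] in auto)
  qed
  ultimately show ?thesis by (simp add: moderate_iff)
qed

lemma negligible_add:
  assumes "u \<in> \<N>" "v \<in> \<N>"
  shows "u \<oplus>\<^bsub>R\<^esub> v \<in> \<N>"
proof -
  have nets: "u \<in> nets \<Omega> X" "v \<in> nets \<Omega> X"
    using assms by (auto intro: moderate_nets negligible_moderate)
  have "negligible_on (C m \<inter> \<Omega>) (pd_net is (u \<oplus>\<^bsub>R\<^esub> v))" if "ordered is" for m "is"
    by (rule negligible_on_cong[OF _ negligible_on_add[of _ "pd_net is u" "pd_net is v"]])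
       (use pd_net_add[OF nets] assms that in \<open>auto simp: negligible_iff\<close>)
  then show ?thesis using assms by (simp add: negligible_iff moderate_add)
qed

lemma negligible_mult:
  assumes "u \<in> moderate \<Omega> X" "v \<in> \<N>"
  shows "u \<otimes>\<^bsub>R\<^esub> v \<in> \<N>"
proof -
  have nets: "u \<in> nets \<Omega> X" "v \<in> nets \<Omega> X"
    using assms by (auto intro: moderate_nets negligible_moderate)
  have "negligible_on (C m \<inter> \<Omega>) (pd_net is (u \<otimes>\<^bsub>R\<^esub> v))" if "ordered is" for m "is"
  proof -
    obtain ps where ps: "\<And>p. p \<in> set ps \<Longrightarrow> ordered (fst p) \<and> ordered (snd p)"
      and eq: "\<And>u v \<psi> x. u \<in> nets \<Omega> X \<Longrightarrow> v \<in> nets \<Omega> X \<Longrightarrow> \<psi> \<in> mollifiers 0 \<Longrightarrow> x \<in> \<Omega> \<Longrightarrow>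
      pd_net is (u \<otimes>\<^bsub>R\<^esub> v) \<psi> x = (\<Sum>p\<leftarrow>ps. pd_net (fst p) u \<psi> x * pd_net (snd p) v \<psi> x)"
      by (rule pd_net_mult[OF \<open>ordered is\<close>]) blast
    show ?thesis
    proof (rule negligible_on_cong)
      show "negligible_on (C m \<inter> \<Omega>)
          (\<lambda>\<psi> x. \<Sum>p\<leftarrow>ps. pd_net (fst p) u \<psi> x * pd_net (snd p) v \<psi> x)"
        using assms ps by (intro negligible_on_sum_list negligible_on_mult)
          (auto simp: moderate_iff negligible_iff)
    qed (use eq[OF nets] in auto)
  qed
  then show ?thesis using assms by (simp add: negligible_iff moderate_mult)
qed

lemma zero_negligible: "\<zero>\<^bsub>R\<^esub> \<in> \<N>"
proof -
  have "negligible_on (C m \<inter> \<Omega>) (pd_net is \<zero>\<^bsub>R\<^esub>)" for m "is"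
  proof (rule negligible_on_cong[OF _ negligible_on_0])
    show "pd_net is \<zero>\<^bsub>R\<^esub> \<psi> x = 0"
      if "\<psi> \<in> mollifiers 0" "x \<in> C m \<inter> \<Omega>" for \<psi> x
      using pd_net_restrict[OF that(1), of x "is" "\<lambda>_. 0"] that(2)
      by (simp add: iter_pd_const zero_moderate_ring)
  qed
  then show ?thesis
    unfolding negligible_iff using const_moderate[of 0] by (simp add: zero_moderate_ring)
qed

lemma cring_moderate_ring: "cring R"
proof (rule cringI)
  have arb: "u (\<psi>, x) = undefined" if "u \<in> moderate \<Omega> X" "\<psi> \<notin> mollifiers 0 \<or> x \<notin> X" for u \<psi> x
    using moderate_nets[OF that(1)] that(2) by (auto simp: nets_def intro: extensional_arb)
  have mem: "\<one>\<^bsub>R\<^esub> \<in> moderate \<Omega> X" "\<zero>\<^bsub>R\<^esub> \<in> moderate \<Omega> X"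
    unfolding one_moderate_ring zero_moderate_ring by (rule const_moderate)+
  show "abelian_group R"
  proof (rule abelian_groupI)
    fix u assume u: "u \<in> carrier R"
    show "\<exists>v\<in>carrier R. v \<oplus>\<^bsub>R\<^esub> u = \<zero>\<^bsub>R\<^esub>"
    proof
      show "restrict (\<lambda>_. - 1) (mollifiers 0 \<times> X) \<otimes>\<^bsub>R\<^esub> u \<in> carrier R"
        using u const_moderate moderate_mult by simp
    qed (auto simp: moderate_ring_ops restrict_def fun_eq_iff)
    show "\<zero>\<^bsub>R\<^esub> \<oplus>\<^bsub>R\<^esub> u = u"
      using u arb[of u] by (auto simp: moderate_ring_ops restrict_def fun_eq_iff)
  next
    show "u \<oplus>\<^bsub>R\<^esub> v \<in> carrier R" if "u \<in> carrier R" "v \<in> carrier R" for u v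
      using that moderate_add by simp
  qed (auto simp: mem moderate_ring_ops(2) restrict_def fun_eq_iff)
  show "comm_monoid R"
  proof (rule comm_monoidI)
    fix u assume u: "u \<in> carrier R"
    show "\<one>\<^bsub>R\<^esub> \<otimes>\<^bsub>R\<^esub> u = u"
      using u arb[of u] by (auto simp: moderate_ring_ops restrict_def fun_eq_iff)
  next
    show "u \<otimes>\<^bsub>R\<^esub> v \<in> carrier R" if "u \<in> carrier R" "v \<in> carrier R" for u v
      using that moderate_mult by simp
  qed (auto simp: mem moderate_ring_ops(1) restrict_def fun_eq_iff)
  show "(u \<oplus>\<^bsub>R\<^esub> v) \<otimes>\<^bsub>R\<^esub> w = u \<otimes>\<^bsub>R\<^esub> w \<oplus>\<^bsub>R\<^esub> v \<otimes>\<^bsub>R\<^esub> w" for u v w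
    by (auto simp: moderate_ring_ops restrict_def fun_eq_iff algebra_simps)
qed

lemma ideal_negligible: "ideal \<N> R"
proof -
  interpret R: cring R by (rule cring_moderate_ring)
  show ?thesis
  proof (rule idealI)
    show "ring R" by (rule R.ring_axioms)
    show mult: "v \<otimes>\<^bsub>R\<^esub> u \<in> \<N>" "u \<otimes>\<^bsub>R\<^esub> v \<in> \<N>" if "u \<in> \<N>" "v \<in> carrier R" for u v
      using negligible_mult[of v u] R.m_comm[of u v] negligible_moderate that by auto
    show "subgroup \<N> (add_monoid R)"
    proof (rule subgroup.intro)
      fix u assume u: "u \<in> \<N>"
      then have "u \<in> carrier R" by (simp add: negligible_moderate)
      then have "\<ominus>\<^bsub>R\<^esub> u = \<ominus>\<^bsub>R\<^esub> \<one>\<^bsub>R\<^esub> \<otimes>\<^bsub>R\<^esub> u"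
        by (simp only: R.l_minus[OF R.one_closed] R.l_one)
      then have "\<ominus>\<^bsub>R\<^esub> u \<in> \<N>"
        using mult(1)[OF u R.a_inv_closed[OF R.one_closed]] by (simp only:)
      then show "inv\<^bsub>add_monoid R\<^esub> u \<in> \<N>" by (simp add: a_inv_def)
    qed (auto simp: negligible_moderate negligible_add zero_negligible)
  qed
qed

section \<open>Invertibility and lower bounds\<close>

lemma bounded_away_iff:
  "bounded_away C u \<longleftrightarrow>
    (\<forall>K. compact K \<and> K \<subseteq> X \<longrightarrow>
       (\<exists>p\<ge>1. \<forall>\<phi> \<in> mollifiers p. \<exists>\<eta>>0. \<forall>\<epsilon>. 0 < \<epsilon> \<and> \<epsilon> < \<eta> \<longrightarrow>
          (INF x\<in>K. ereal \<bar>u (rescale \<epsilon> \<phi>, x)\<bar>) \<ge> ereal (\<epsilon> ^ p)))"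
  unfolding ex_eta_iff le_INF_iff ereal_less_eq
proof (intro iffI allI impI)
  fix K assume b: "bounded_away C u" and "compact K \<and> K \<subseteq> X"
  then obtain m where m: "K \<subseteq> C m" using absorbs by blast
  obtain p where p: "\<And>\<phi>. \<phi> \<in> mollifiers p \<Longrightarrow>
      \<forall>\<^sub>F \<epsilon> in at_right 0. \<forall>x\<in>C m. \<epsilon> ^ p \<le> \<bar>u (rescale \<epsilon> \<phi>, x)\<bar>"
    using b unfolding bounded_away_def by blast
  have "\<forall>\<^sub>F \<epsilon> in at_right 0. \<forall>x\<in>K. \<epsilon> ^ Suc p \<le> \<bar>u (rescale \<epsilon> \<phi>, x)\<bar>"
    if \<phi>: "\<phi> \<in> mollifiers (Suc p)" for \<phi> :: "real ^ 'n \<Rightarrow> real"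
    using p[OF mollifiers_antimono[OF \<phi> le_SucI[OF le_refl]]] eventually_small[of 0]
  proof eventually_elim
    case (elim \<epsilon>)
    then have "\<epsilon> ^ Suc p \<le> \<epsilon> ^ p" by (intro power_decreasing) auto
    with elim(1) m show ?case by (meson order_trans subsetD)
  qed
  then show "\<exists>p\<ge>1. \<forall>\<phi>\<in>mollifiers p. \<forall>\<^sub>F \<epsilon> in at_right 0. \<forall>x\<in>K. \<epsilon> ^ p \<le> \<bar>u (rescale \<epsilon> \<phi>, x)\<bar>"
    by (intro exI[of _ "Suc p"]) auto
next
  assume lower: "\<forall>K. compact K \<and> K \<subseteq> X \<longrightarrow>
    (\<exists>p\<ge>1. \<forall>\<phi>\<in>mollifiers p. \<forall>\<^sub>F \<epsilon> in at_right 0. \<forall>x\<in>K. \<epsilon> ^ p \<le> \<bar>u (rescale \<epsilon> \<phi>, x)\<bar>)"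
  show "bounded_away C u"
    unfolding bounded_away_def
  proof
    fix m
    from lower[THEN spec, THEN mp, OF conjI[OF compact_C C_subset], of m]
    show "\<exists>p. \<forall>\<phi>\<in>mollifiers p. \<forall>\<^sub>F \<epsilon> in at_right 0. \<forall>x\<in>C m. \<epsilon> ^ p \<le> \<bar>u (rescale \<epsilon> \<phi>, x)\<bar>"
      by blast
  qed
qed

text \<open>For \<open>\<epsilon> \<le> 1 / 2\<close>, from \<open>\<bar>h\<bar> \<le> \<epsilon>\<close> and \<open>\<bar>v\<bar> \<le> 1 / \<epsilon> ^ M\<close> one gets
  \<open>\<bar>u\<bar> \<ge> (1 - \<epsilon>) \<epsilon> ^ M \<ge> \<epsilon> ^ Suc M\<close>. The bounds hold in \<open>\<Omega>\<close> and pass to the boundary by continuity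
  of \<open>u\<close>.\<close>

lemma bounded_away_if_invertible:
  assumes u: "u \<in> moderate \<Omega> X" and v: "v \<in> moderate \<Omega> X" and h: "h \<in> \<N>"
    and uv: "u \<otimes>\<^bsub>R\<^esub> v = h \<oplus>\<^bsub>R\<^esub> \<one>\<^bsub>R\<^esub>"
  shows "bounded_away C u"
  unfolding bounded_away_def
proof
  fix m
  have "moderate_on (C (Suc m) \<inter> \<Omega>) (pd_net [] v)"
    using moderate_iff[THEN iffD1, OF v] ordered_Nil by blast
  then obtain M where M: "\<And>\<phi>. \<phi> \<in> mollifiers M \<Longrightarrow>
      \<forall>\<^sub>F \<epsilon> in at_right 0. \<forall>x\<in>C (Suc m) \<inter> \<Omega>. \<bar>v (rescale \<epsilon> \<phi>, x)\<bar> \<le> 1 / \<epsilon> ^ M"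
    unfolding iter_pd_Nil by (rule moderate_onE) blast
  have "negligible_on (C (Suc m) \<inter> \<Omega>) (pd_net [] h)"
    using negligible_iff[THEN iffD1, OF h] ordered_Nil by blast
  then obtain L where L: "\<And>q \<phi>. L \<le> q \<Longrightarrow> \<phi> \<in> mollifiers q \<Longrightarrow>
      \<forall>\<^sub>F \<epsilon> in at_right 0. \<forall>x\<in>C (Suc m) \<inter> \<Omega>. \<bar>h (rescale \<epsilon> \<phi>, x)\<bar> \<le> \<epsilon> ^ (q - L)"
    unfolding iter_pd_Nil by (rule negligible_onE) blast
  let ?p = "Suc (M + L)"
  have "\<forall>\<^sub>F \<epsilon> in at_right 0. \<forall>x\<in>C m. \<epsilon> ^ ?p \<le> \<bar>u (rescale \<epsilon> \<phi>, x)\<bar>"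
    if \<phi>: "\<phi> \<in> mollifiers ?p" for \<phi> :: "real ^ 'n \<Rightarrow> real"
  proof -
    have \<phi>': "\<phi> \<in> mollifiers M" "\<phi> \<in> mollifiers (Suc L)" using \<phi> by (auto elim: mollifiers_antimono)
    show ?thesis
      using M[OF \<phi>'(1)] L[of "Suc L", OF _ \<phi>'(2), simplified] eventually_small[of 2]
        eventually_rescale_mollifiers[OF \<phi>]
    proof eventually_elim
      case (elim \<epsilon>)
      let ?\<psi> = "rescale \<epsilon> \<phi>"
      have e: "0 < \<epsilon>" "\<epsilon> < 1" "2 * \<epsilon> \<le> 1" using elim(3) by auto
      have "u (?\<psi>, x) \<in> {y. \<epsilon> ^ ?p \<le> \<bar>y\<bar>}" if x: "x \<in> C m" for x
      proof (rule closed_condition_on_C[OF nets_continuous_on[OF moderate_nets[OF u] elim(4)] _ _ x])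
        show "closed {y :: real. \<epsilon> ^ ?p \<le> \<bar>y\<bar>}"
          by (intro closed_Collect_le continuous_intros)
        fix y assume y: "y \<in> C (Suc m) \<inter> \<Omega>"
        then have "(?\<psi>, y) \<in> mollifiers 0 \<times> X" using elim(4) Omega_subset by auto
        then have "u (?\<psi>, y) * v (?\<psi>, y) = h (?\<psi>, y) + 1"
          using fun_cong[OF uv, of "(?\<psi>, y)"] by (simp add: moderate_ring_ops)
        moreover have "\<bar>h (?\<psi>, y)\<bar> \<le> \<epsilon>" using elim(2) y by auto
        ultimately have "1 - \<epsilon> \<le> \<bar>u (?\<psi>, y) * v (?\<psi>, y)\<bar>" by linarith
        also have "\<dots> \<le> \<bar>u (?\<psi>, y)\<bar> * (1 / \<epsilon> ^ M)"
          unfolding abs_mult using elim(1) y by (intro mult_left_mono) auto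
        finally have "(1 - \<epsilon>) * \<epsilon> ^ M \<le> \<bar>u (?\<psi>, y)\<bar>"
          using e(1) by (simp add: field_simps)
        moreover have "\<epsilon> * \<epsilon> ^ M \<le> (1 - \<epsilon>) * \<epsilon> ^ M"
          using e by (intro mult_right_mono) auto
        moreover have "\<epsilon> ^ ?p \<le> \<epsilon> ^ Suc M"
          using e by (intro power_decreasing) auto
        ultimately show "u (?\<psi>, y) \<in> {y. \<epsilon> ^ ?p \<le> \<bar>y\<bar>}" by simp
      qed
      then show ?case by blast
    qed
  qed
  then show "\<exists>p. \<forall>\<phi>\<in>mollifiers p. \<forall>\<^sub>F \<epsilon> in at_right 0. \<forall>x\<in>C m. \<epsilon> ^ p \<le> \<bar>u (rescale \<epsilon> \<phi>, x)\<bar>"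
    by blast
qed

text \<open>The net \<open>u / (u\<^sup>2 + d)\<close> with \<open>d\<close> from \<open>regularizer\<close>. Its denominator is positive for every
  mollifier, and once \<open>u (\<phi>\<^sub>\<epsilon>, \<cdot>)\<close> has no zero on \<open>C (Suc m)\<close> it equals \<open>1 / u\<close> on \<open>C m\<close>.\<close>

lemma local_inverse_exists:
  assumes u: "u \<in> nets \<Omega> X" and b: "bounded_away C u"
  obtains v where "v \<in> nets \<Omega> X"
    "\<forall>m. \<exists>p. \<forall>\<phi>\<in>mollifiers p. \<forall>\<^sub>F \<epsilon> in at_right 0.
       \<forall>x\<in>C m. \<epsilon> ^ p \<le> \<bar>u (rescale \<epsilon> \<phi>, x)\<bar> \<and> u (rescale \<epsilon> \<phi>, x) * v (rescale \<epsilon> \<phi>, x) = 1"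
proof -
  have "\<exists>d. smooth_on UNIV d \<and> (\<forall>x\<in>X. 0 < u (\<psi>, x) * u (\<psi>, x) + d x) \<and>
      (\<forall>m. (\<forall>y\<in>C (Suc m). u (\<psi>, y) \<noteq> 0) \<longrightarrow> (\<forall>x\<in>C m. d x = 0))" for \<psi>
    by (rule regularizer[of "\<lambda>x. u (\<psi>, x)"]) blast
  then obtain d where d: "\<And>\<psi>. smooth_on UNIV (d \<psi>)"
      "\<And>\<psi> x. x \<in> X \<Longrightarrow> 0 < u (\<psi>, x) * u (\<psi>, x) + d \<psi> x"
      "\<And>\<psi> m x. \<forall>y\<in>C (Suc m). u (\<psi>, y) \<noteq> 0 \<Longrightarrow> x \<in> C m \<Longrightarrow> d \<psi> x = 0"
    by metis
  define v where "v = (\<lambda>(\<psi>, x)\<in>mollifiers 0 \<times> X. u (\<psi>, x) * inverse (u (\<psi>, x) * u (\<psi>, x) + d \<psi> x))"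
  have "v \<in> nets \<Omega> X"
    unfolding v_def
  proof (rule restrict_in_nets, unfold prod.case)
    fix \<psi> :: "real ^ 'n \<Rightarrow> real" assume "\<psi> \<in> mollifiers 0"
    then show "smooth_upto \<Omega> X (\<lambda>x. u (\<psi>, x) * inverse (u (\<psi>, x) * u (\<psi>, x) + d \<psi> x))"
      using less_imp_neq[OF d(2), symmetric]
      by (intro smooth_upto_mult smooth_upto_inverse smooth_upto_add
          smooth_upto_if_smooth_on_UNIV[OF d(1)] nets_smooth_upto[OF u]) auto
  qed
  moreover have "\<exists>p. \<forall>\<phi>\<in>mollifiers p. \<forall>\<^sub>F \<epsilon> in at_right 0.
       \<forall>x\<in>C m. \<epsilon> ^ p \<le> \<bar>u (rescale \<epsilon> \<phi>, x)\<bar> \<and> u (rescale \<epsilon> \<phi>, x) * v (rescale \<epsilon> \<phi>, x) = 1" for m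
  proof -
    obtain p where p: "\<And>\<phi>. \<phi> \<in> mollifiers p \<Longrightarrow>
        \<forall>\<^sub>F \<epsilon> in at_right 0. \<forall>x\<in>C (Suc m). \<epsilon> ^ p \<le> \<bar>u (rescale \<epsilon> \<phi>, x)\<bar>"
      using b unfolding bounded_away_def by blast
    have "\<forall>\<^sub>F \<epsilon> in at_right 0.
       \<forall>x\<in>C m. \<epsilon> ^ p \<le> \<bar>u (rescale \<epsilon> \<phi>, x)\<bar> \<and> u (rescale \<epsilon> \<phi>, x) * v (rescale \<epsilon> \<phi>, x) = 1"
      if \<phi>: "\<phi> \<in> mollifiers p" for \<phi> :: "real ^ 'n \<Rightarrow> real"
      using p[OF \<phi>] eventually_small[of 0] eventually_rescale_mollifiers[OF \<phi>]
    proof eventually_elim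
      case (elim \<epsilon>)
      let ?\<psi> = "rescale \<epsilon> \<phi>"
      have pos: "0 < \<epsilon> ^ p" using elim(2) by simp
      have ne: "\<forall>y\<in>C (Suc m). u (?\<psi>, y) \<noteq> 0"
      proof
        fix y assume "y \<in> C (Suc m)"
        then have "\<epsilon> ^ p \<le> \<bar>u (?\<psi>, y)\<bar>" using elim(1) by blast
        with pos show "u (?\<psi>, y) \<noteq> 0" by auto
      qed
      show ?case
      proof
        fix x assume x: "x \<in> C m"
        then have x': "x \<in> C (Suc m)" "x \<in> X" using C_mono[of m "Suc m"] C_subset by auto
        have "v (?\<psi>, x) = u (?\<psi>, x) * inverse (u (?\<psi>, x) * u (?\<psi>, x))"
          using x'(2) elim(3) d(3)[OF ne x] by (simp add: v_def)
        then show "\<epsilon> ^ p \<le> \<bar>u (?\<psi>, x)\<bar> \<and> u (?\<psi>, x) * v (?\<psi>, x) = 1"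
          using ne x'(1) elim(1) by (simp add: field_simps)
      qed
    qed
    then show ?thesis by blast
  qed
  ultimately show thesis using that by blast
qed

text \<open>The local inverse \<open>v\<close> itself is moderate by the lower bound on \<open>u\<close>; its derivatives are so by
  induction along \<open>leibniz_reciprocal\<close>, applied on the open set \<open>W m \<inter> \<Omega>\<close> where \<open>u v = 1\<close> eventually.\<close>

lemma invertible_if_bounded_away:
  assumes u: "u \<in> moderate \<Omega> X" and b: "bounded_away C u"
  shows "\<exists>v\<in>moderate \<Omega> X. u \<otimes>\<^bsub>R\<^esub> v \<ominus>\<^bsub>R\<^esub> \<one>\<^bsub>R\<^esub> \<in> \<N>"
proof -
  interpret R: cring R by (rule cring_moderate_ring)
  have u_nets: "u \<in> nets \<Omega> X" using u by (rule moderate_nets)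
  obtain v where v: "v \<in> nets \<Omega> X" and uv: "\<forall>m. \<exists>p. \<forall>\<phi>\<in>mollifiers p. \<forall>\<^sub>F \<epsilon> in at_right 0.
       \<forall>x\<in>C m. \<epsilon> ^ p \<le> \<bar>u (rescale \<epsilon> \<phi>, x)\<bar> \<and> u (rescale \<epsilon> \<phi>, x) * v (rescale \<epsilon> \<phi>, x) = 1"
    by (rule local_inverse_exists[OF u_nets b])
  have v_bound: "moderate_on (C m \<inter> \<Omega>) (pd_net [] v)" for m
  proof -
    obtain p where p: "\<And>\<phi>. \<phi> \<in> mollifiers p \<Longrightarrow> \<forall>\<^sub>F \<epsilon> in at_right 0.
       \<forall>x\<in>C m. \<epsilon> ^ p \<le> \<bar>u (rescale \<epsilon> \<phi>, x)\<bar> \<and> u (rescale \<epsilon> \<phi>, x) * v (rescale \<epsilon> \<phi>, x) = 1"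
      using uv by blast
    show ?thesis
    proof (rule moderate_onI[where N = p], rule exI[of _ 1])
      fix \<phi> :: "real ^ 'n \<Rightarrow> real" assume "\<phi> \<in> mollifiers p"
      from p[OF this] eventually_small[of 0]
      show "\<forall>\<^sub>F \<epsilon> in at_right 0. \<forall>x\<in>C m \<inter> \<Omega>. \<bar>pd_net [] v (rescale \<epsilon> \<phi>) x\<bar> \<le> 1 / \<epsilon> ^ p"
      proof eventually_elim
        case (elim \<epsilon>)
        show ?case
        proof
          fix x assume "x \<in> C m \<inter> \<Omega>"
          with elim have x: "\<epsilon> ^ p \<le> \<bar>u (rescale \<epsilon> \<phi>, x)\<bar>"
            "u (rescale \<epsilon> \<phi>, x) * v (rescale \<epsilon> \<phi>, x) = 1" and e: "0 < \<epsilon> ^ p" by auto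
          have "\<bar>v (rescale \<epsilon> \<phi>, x)\<bar> = 1 / \<bar>u (rescale \<epsilon> \<phi>, x)\<bar>"
            using x(2) by (metis abs_divide abs_one eq_divide_imp mult.commute mult_zero_left zero_neq_one)
          also have "\<dots> \<le> 1 / \<epsilon> ^ p"
            using x(1) e by (intro divide_left_mono) auto
          finally show "\<bar>pd_net [] v (rescale \<epsilon> \<phi>) x\<bar> \<le> 1 / \<epsilon> ^ p" by simp
        qed
      qed
    qed
  qed
  have "moderate_on (C m \<inter> \<Omega>) (pd_net is v)" if "ordered is" for m "is"
    using that
  proof (induction "is" rule: length_induct)
    case (1 "is")
    obtain ps where
      ps: "\<And>js ks. (js, ks) \<in> set ps \<Longrightarrow> subseq js is \<and> subseq ks is \<and> length ks < length is"
      and eq: "\<And>S f g x. \<lbrakk>open S; smooth_on S f; smooth_on S g; \<And>y. y \<in> S \<Longrightarrow> f y * g y = 1; x \<in> S\<rbrakk> \<Longrightarrow>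
       iter_pd is g x
         = g x * ((if is = [] then 1 else 0) - (\<Sum>(js, ks)\<leftarrow>ps. iter_pd js f x * iter_pd ks g x))"
      by (rule leibniz_reciprocal[of "is"]) blast
    have ord: "ordered (fst p) \<and> ordered (snd p) \<and> length (snd p) < length is" if "p \<in> set ps" for p
      using ps[of "fst p" "snd p"] that ordered_subseq[OF "1.prems"] by simp
    obtain p where p: "\<And>\<phi>. \<phi> \<in> mollifiers p \<Longrightarrow> \<forall>\<^sub>F \<epsilon> in at_right 0.
       \<forall>x\<in>C (Suc m). \<epsilon> ^ p \<le> \<bar>u (rescale \<epsilon> \<phi>, x)\<bar> \<and> u (rescale \<epsilon> \<phi>, x) * v (rescale \<epsilon> \<phi>, x) = 1"
      using uv by blast
    let ?D = "\<lambda>\<psi> x. pd_net [] v \<psi> x * ((if is = [] then 1 else 0)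
        + - 1 * (\<Sum>p\<leftarrow>ps. pd_net (fst p) u \<psi> x * pd_net (snd p) v \<psi> x))"
    have "moderate_on (C m \<inter> \<Omega>) ?D"
      using u ord "1.IH"
      by (intro moderate_on_mult moderate_on_add moderate_on_const moderate_on_sum_list v_bound)
         (auto simp: moderate_iff)
    then show ?case
    proof (rule moderate_on_eventually_eq)
      fix \<phi> :: "real ^ 'n \<Rightarrow> real" assume \<phi>: "\<phi> \<in> mollifiers p"
      from p[OF \<phi>] eventually_rescale_mollifiers[OF \<phi>]
      show "\<forall>\<^sub>F \<epsilon> in at_right 0. \<forall>x\<in>C m \<inter> \<Omega>. pd_net is v (rescale \<epsilon> \<phi>) x = ?D (rescale \<epsilon> \<phi>) x"
      proof eventually_elim
        case (elim \<epsilon>)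
        let ?S = "W m \<inter> \<Omega>"
        have S: "open ?S" "?S \<subseteq> \<Omega>" using open_W open_Omega by auto
        have "u (rescale \<epsilon> \<phi>, y) * v (rescale \<epsilon> \<phi>, y) = 1" if "y \<in> ?S" for y
          using elim(1) that W_subset_C[of m] Omega_subset by blast
        note * = eq[OF S(1) nets_smooth_on[OF u_nets elim(2), THEN smooth_on_subset[OF _ S(2)]]
            nets_smooth_on[OF v elim(2), THEN smooth_on_subset[OF _ S(2)]] this]
        show ?case using * C_subset_W by (fastforce simp: case_prod_unfold)
      qed
    qed
  qed
  with v have v_mod: "v \<in> moderate \<Omega> X" by (simp add: moderate_iff)
  let ?h = "u \<otimes>\<^bsub>R\<^esub> v \<oplus>\<^bsub>R\<^esub> restrict (\<lambda>_. - 1) (mollifiers 0 \<times> X)"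
  have minus_one: "\<ominus>\<^bsub>R\<^esub> \<one>\<^bsub>R\<^esub> = restrict (\<lambda>_. - 1) (mollifiers 0 \<times> X)"
  proof (rule R.minus_equality)
    show "restrict (\<lambda>_. - 1) (mollifiers 0 \<times> X) \<in> carrier R"
      using const_moderate by simp
  qed (simp_all only: R.one_closed, auto simp: moderate_ring_ops restrict_def fun_eq_iff)
  have "?h \<in> \<N>"
    unfolding negligible_iff
  proof (intro conjI allI impI)
    show "?h \<in> moderate \<Omega> X"
      by (intro moderate_add moderate_mult u v_mod const_moderate)
    fix m and "is" :: "'n list"
    obtain p where p: "\<And>\<phi>. \<phi> \<in> mollifiers p \<Longrightarrow> \<forall>\<^sub>F \<epsilon> in at_right 0.
       \<forall>x\<in>C (Suc m). \<epsilon> ^ p \<le> \<bar>u (rescale \<epsilon> \<phi>, x)\<bar> \<and> u (rescale \<epsilon> \<phi>, x) * v (rescale \<epsilon> \<phi>, x) = 1"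
      using uv by blast
    show "negligible_on (C m \<inter> \<Omega>) (pd_net is ?h)"
    proof (rule negligible_on_eventually_eq[OF negligible_on_0])
      fix \<phi> :: "real ^ 'n \<Rightarrow> real" assume \<phi>: "\<phi> \<in> mollifiers p"
      from p[OF \<phi>] eventually_rescale_mollifiers[OF \<phi>]
      show "\<forall>\<^sub>F \<epsilon> in at_right 0. \<forall>x\<in>C m \<inter> \<Omega>. pd_net is ?h (rescale \<epsilon> \<phi>) x = 0"
      proof eventually_elim
        case (elim \<epsilon>)
        have zero: "?h (rescale \<epsilon> \<phi>, y) = 0" if "y \<in> W m \<inter> \<Omega>" for y
        proof -
          have "y \<in> C (Suc m)" "y \<in> X" using that W_subset_C[of m] Omega_subset by auto
          then show ?thesis using elim by (simp add: moderate_ring_ops)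
        qed
        show ?case
        proof
          fix x assume "x \<in> C m \<inter> \<Omega>"
          then have "x \<in> W m \<inter> \<Omega>" using C_subset_W by auto
          then have "pd_net is ?h (rescale \<epsilon> \<phi>) x = iter_pd is (\<lambda>_. 0) x"
            by (intro iter_pd_cong_open[OF open_Int[OF open_W open_Omega]] zero)
          then show "pd_net is ?h (rescale \<epsilon> \<phi>) x = 0" by (simp add: iter_pd_const)
        qed
      qed
    qed
  qed
  then have "u \<otimes>\<^bsub>R\<^esub> v \<ominus>\<^bsub>R\<^esub> \<one>\<^bsub>R\<^esub> \<in> \<N>" by (simp add: a_minus_def minus_one)
  with v_mod show ?thesis by blast
qed

text \<open>The product of the cosets of \<open>u\<close> and \<open>v\<close> is the unit iff \<open>u v - 1\<close> is negligible. As any element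
  of the coset \<open>U\<close> may play the role of \<open>u\<close>, the bound holds for all representatives as soon as it
  holds for one.\<close>

theorem invertible_iff_bounded_away:
  assumes U: "U \<in> carrier (colombeau \<Omega> X)"
  shows "(\<exists>V\<in>carrier (colombeau \<Omega> X).
      U \<otimes>\<^bsub>colombeau \<Omega> X\<^esub> V = \<one>\<^bsub>colombeau \<Omega> X\<^esub>) \<longleftrightarrow> (\<forall>u\<in>U. bounded_away C u)"
proof -
  interpret R: cring R by (rule cring_moderate_ring)
  interpret N: ideal \<N> R by (rule ideal_negligible)
  have carrier: "carrier (colombeau \<Omega> X) = {\<N> +>\<^bsub>R\<^esub> u |u. u \<in> moderate \<Omega> X}"
    by (auto simp: colombeau_def FactRing_def A_RCOSETS_def')
  have one: "\<one>\<^bsub>colombeau \<Omega> X\<^esub> = \<N> +>\<^bsub>R\<^esub> \<one>\<^bsub>R\<^esub>"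
    by (simp add: colombeau_def FactRing_def)
  have mult: "(\<N> +>\<^bsub>R\<^esub> u) \<otimes>\<^bsub>colombeau \<Omega> X\<^esub> (\<N> +>\<^bsub>R\<^esub> v) = \<N> +>\<^bsub>R\<^esub> (u \<otimes>\<^bsub>R\<^esub> v)"
    if "u \<in> moderate \<Omega> X" "v \<in> moderate \<Omega> X" for u v
    using that by (simp add: colombeau_def FactRing_def N.rcoset_mult_add)
  obtain w where w: "w \<in> moderate \<Omega> X" "U = \<N> +>\<^bsub>R\<^esub> w" using U carrier by auto
  have rep: "u \<in> moderate \<Omega> X \<and> U = \<N> +>\<^bsub>R\<^esub> u" if "u \<in> U" for u
    using that w N.a_repr_independence'[of u w] N.a_Hcarr
    by (auto simp: a_r_coset_def' negligible_moderate moderate_add)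
  have key: "(\<exists>v\<in>moderate \<Omega> X. U \<otimes>\<^bsub>colombeau \<Omega> X\<^esub> (\<N> +>\<^bsub>R\<^esub> v) = \<one>\<^bsub>colombeau \<Omega> X\<^esub>)
      \<longleftrightarrow> bounded_away C u" if "u \<in> U" for u
  proof -
    have u: "u \<in> moderate \<Omega> X" and U: "U = \<N> +>\<^bsub>R\<^esub> u" using rep[OF that] by auto
    have "(U \<otimes>\<^bsub>colombeau \<Omega> X\<^esub> (\<N> +>\<^bsub>R\<^esub> v) = \<one>\<^bsub>colombeau \<Omega> X\<^esub>)
        \<longleftrightarrow> u \<otimes>\<^bsub>R\<^esub> v \<ominus>\<^bsub>R\<^esub> \<one>\<^bsub>R\<^esub> \<in> \<N>" if "v \<in> moderate \<Omega> X" for v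
      unfolding U mult[OF u that] one
      by (rule R.quotient_eq_iff_same_a_r_cos[OF ideal_negligible, symmetric])
         (use u that moderate_mult R.one_closed in auto)
    moreover have "bounded_away C u" if v: "v \<in> moderate \<Omega> X" "u \<otimes>\<^bsub>R\<^esub> v \<ominus>\<^bsub>R\<^esub> \<one>\<^bsub>R\<^esub> \<in> \<N>" for v
    proof (rule bounded_away_if_invertible[OF u v])
      show "u \<otimes>\<^bsub>R\<^esub> v = u \<otimes>\<^bsub>R\<^esub> v \<ominus>\<^bsub>R\<^esub> \<one>\<^bsub>R\<^esub> \<oplus>\<^bsub>R\<^esub> \<one>\<^bsub>R\<^esub>"
      proof -
        have "u \<otimes>\<^bsub>R\<^esub> v \<in> carrier R" using u v(1) moderate_mult by simp
        then show ?thesis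
          by (simp only: a_minus_def R.a_assoc R.a_inv_closed R.one_closed R.l_neg R.r_zero)
      qed
    qed
    ultimately show ?thesis using invertible_if_bounded_away[OF u] by blast
  qed
  have "w \<in> U" using w N.a_rcos_self by simp
  show ?thesis using key \<open>w \<in> U\<close> unfolding carrier by blast
qed

end

text \<open>For \<open>X = \<Omega>\<close> the sets keep away from the boundary; for the closure, intersections with large balls
  are already compact.\<close>

lemma exhaustion_exists:
  fixes \<Omega> X :: "(real ^ 'n) set"
  assumes "open \<Omega>" "X = \<Omega> \<or> X = closure \<Omega>"
  obtains C W where "exhausted_region \<Omega> X C W"
  using assms(2)
proof
  assume X: "X = \<Omega>"
  obtain C where C: "\<And>n. compact (C n)" "\<And>n. C n \<subseteq> \<Omega>" "\<And>n. C n \<subseteq> interior (C (Suc n))"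
    "\<And>K. \<lbrakk>compact K; K \<subseteq> \<Omega>\<rbrakk> \<Longrightarrow> \<exists>N. \<forall>n\<ge>N. K \<subseteq> C n"
    using open_Union_compact_subsets[OF assms(1)] by metis
  have "exhausted_region \<Omega> X C (\<lambda>n. interior (C (Suc n)))"
  proof
    show "\<exists>m. K \<subseteq> C m" if "compact K" "K \<subseteq> X" for K
      using C(4)[of K] that X by blast
  qed (auto simp: X assms(1) C(1) intro: subsetD[OF closure_subset] subsetD[OF C(2)] subsetD[OF C(3)]
      subsetD[OF interior_subset])
  then show thesis by (rule that)
next
  assume X: "X = closure \<Omega>"
  have "exhausted_region \<Omega> X (\<lambda>n. X \<inter> cball 0 (real n)) (\<lambda>n. ball 0 (real (Suc n)))"
  proof
    show "\<exists>m. K \<subseteq> X \<inter> cball 0 (real m)" if "compact K" "K \<subseteq> X" for K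
    proof -
      obtain r where r: "\<And>x. x \<in> K \<Longrightarrow> norm x \<le> r"
        using compact_imp_bounded[OF \<open>compact K\<close>] by (auto simp: bounded_iff)
      obtain m :: nat where "r \<le> real m" using real_arch_simple by blast
      with r that(2) show ?thesis by (intro exI[of _ m]) (force intro: order_trans)
    qed
    show "compact (X \<inter> cball 0 (real m))" for m
      unfolding X by (intro closed_Int_compact) auto
  qed (use assms(1) X closure_subset in auto)
  then show thesis by (rule that)
qed

section \<open>The characterisation of invertible elements\<close>

theorem theorem1:
  fixes \<Omega> X :: "(real ^ 'n) set" and U :: "'n net set"
  assumes "open \<Omega>" and "connected \<Omega>" and "\<Omega> \<noteq> {}"
    and "X = \<Omega> \<or> X = closure \<Omega>"
    and "U \<in> carrier (colombeau \<Omega> X)"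
  shows "(\<exists>V \<in> carrier (colombeau \<Omega> X).
            U \<otimes>\<^bsub>colombeau \<Omega> X\<^esub> V = \<one>\<^bsub>colombeau \<Omega> X\<^esub>) \<longleftrightarrow>
         (\<forall>u \<in> U. \<forall>K. compact K \<and> K \<subseteq> X \<longrightarrow>
            (\<exists>p\<ge>1. \<forall>\<phi> \<in> mollifiers p. \<exists>\<eta>>0. \<forall>\<epsilon>. 0 < \<epsilon> \<and> \<epsilon> < \<eta> \<longrightarrow>
               (INF x\<in>K. ereal \<bar>u (rescale \<epsilon> \<phi>, x)\<bar>) \<ge> ereal (\<epsilon> ^ p)))"
proof -
  obtain C W where "exhausted_region \<Omega> X C W"
    by (rule exhaustion_exists[OF assms(1,4)])
  then interpret exhausted_region \<Omega> X C W .
  show ?thesis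
    using invertible_iff_bounded_away[OF assms(5)] by (simp only: bounded_away_iff)
qed

end
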